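(* Let $q$ be an odd prime power, and let $\mathbf{A}$ be the $0$-$1$ incidence matrix, regarded over $\mathbb{F}_2$, whose rows are indexed by the passant lines and whose columns are indexed by the internal points of the conic $\mathcal{O}$ in $\mathrm{PG}(2,q)$ (the entry is $1$ exactly when the point lies on the line). Let $\mathcal{L}$ be the $\mathbb{F}_2$-null space of $\mathbf{A}$. Then $$\dim_{\mathbb{F}_2}(\mathcal{L})=\frac{(q-1)^2}{4}.$$
   Context: $\mathrm{PG}(2,q)$ is the classical projective plane over $\mathbb{F}_q$ in homogeneous coordinates: points are nonzero row vectors $(a_0,a_1,a_2)$ up to scalar, lines are $[b_0,b_1,b_2]$ up to scalar (not all $b_i$ zero), and $(a_0,a_1,a_2)$ lies on $[b_0,b_1,b_2]$ iff $a_0b_0+a_1b_1+a_2b_2=0$. The conic is $\mathcal{O}=\{(1,r,r^2)\mid r\in\mathbb{F}_q\}\cup\{(0,0,1)\}$, the zero set of $X_1^2-X_0X_2$. A line is passant, tangent or secant if it meets $\mathcal{O}$ in $0$, $1$ or $2$ points, respectively. A point not on $\mathcal{O}$ is internal if it lies on $0$ tangent lines and external if it lies on $2$ tangent lines. There are $q(q-1)/2$ passant lines and $q(q-1)/2$ internal points. *)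

theory Defs
  imports
    "HOL-Analysis.Analysis"
    "HOL-Library.Z2"
    "HOL-Library.Function_Algebras"
    "HOL-Number_Theory.Prime_Powers"
begin

(* F_q is an arbitrary finite field type 'a with CARD('a) = q.  The homogeneous coordinates
   X_0, X_1, X_2 are the components $1, $2, $3 of 'a ^ 3, and F_2 is the field type bit. *)

definition proj_rel :: "('a::field ^ 3) rel" where
  "proj_rel = {(v, w). v \<noteq> 0 \<and> w \<noteq> 0 \<and> (\<exists>c. c \<noteq> 0 \<and> w = c *s v)}"

definition proj_class :: "'a::field ^ 3 \<Rightarrow> ('a ^ 3) set" where
  "proj_class v = proj_rel `` {v}"

definition pg_points :: "('a::field ^ 3) set set" where
  "pg_points = {v. v \<noteq> 0} // proj_rel"

(* A line is represented by its dual coordinates, so as a set it is a class of coordinate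
   vectors and not the set of the points on it; see incident. *)
definition pg_lines :: "('a::field ^ 3) set set" where
  "pg_lines = {v. v \<noteq> 0} // proj_rel"

definition incident :: "('a::field ^ 3) set \<Rightarrow> ('a ^ 3) set \<Rightarrow> bool" where
  "incident P l \<longleftrightarrow> (\<forall>a\<in>P. \<forall>b\<in>l. a $ 1 * b $ 1 + a $ 2 * b $ 2 + a $ 3 * b $ 3 = 0)"

definition conic_points :: "('a::field ^ 3) set set" where
  "conic_points = range (\<lambda>r. proj_class (vector [1, r, r\<^sup>2])) \<union> {proj_class (vector [0, 0, 1])}"

definition passant_lines :: "('a::field ^ 3) set set" where
  "passant_lines = {l \<in> pg_lines. card {P \<in> conic_points. incident P l} = 0}"

definition tangent_lines :: "('a::field ^ 3) set set" where
  "tangent_lines = {l \<in> pg_lines. card {P \<in> conic_points. incident P l} = 1}"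

definition internal_points :: "('a::field ^ 3) set set" where
  "internal_points =
     {P \<in> pg_points. P \<notin> conic_points \<and> card {l \<in> tangent_lines. incident P l} = 0}"

definition incidence_matrix :: "('a::field ^ 3) set \<Rightarrow> ('a ^ 3) set \<Rightarrow> bit" where
  "incidence_matrix l P = (if incident P l then 1 else 0)"

(* Column vectors of a matrix with column index set C are represented by the functions that
   vanish outside C. *)
definition null_space :: "'r set \<Rightarrow> 'c set \<Rightarrow> ('r \<Rightarrow> 'c \<Rightarrow> 'k::field) \<Rightarrow> ('c \<Rightarrow> 'k) set" where
  "null_space R C A =
     {x. (\<forall>j. j \<notin> C \<longrightarrow> x j = 0) \<and> (\<forall>i\<in>R. (\<Sum>j\<in>C. A i j * x j) = 0)}"

definition fun_scale :: "'k::field \<Rightarrow> ('c \<Rightarrow> 'k) \<Rightarrow> 'c \<Rightarrow> 'k" where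
  "fun_scale c x = (\<lambda>j. c * x j)"

global_interpretation fun_space: vector_space fun_scale
  by unfold_locales (auto simp: fun_scale_def fun_eq_iff algebra_simps)

lemma subspace_null_space: "fun_space.subspace (null_space R C A)"
proof -
  have "(\<Sum>j\<in>C. A i j * (c * x j)) = c * (\<Sum>j\<in>C. A i j * x j)" for i c x
    unfolding sum_distrib_left by (rule sum.cong) (simp_all add: mult.left_commute)
  then show ?thesis
    by (simp add: fun_space.subspace_def null_space_def fun_scale_def distrib_left sum.distrib)
qed

lemma equiv_proj_rel: "equiv {v :: 'a::field ^ 3. v \<noteq> 0} proj_rel"
proof (rule equivI)
  show "proj_rel \<subseteq> {v :: 'a ^ 3. v \<noteq> 0} \<times> {v. v \<noteq> 0}"
    by (auto simp: proj_rel_def)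
  show "refl_on {v :: 'a ^ 3. v \<noteq> 0} proj_rel"
    by (auto simp: refl_on_def proj_rel_def intro!: exI[of _ 1])
  show "sym (proj_rel :: ('a ^ 3) rel)"
  proof (rule symI)
    fix v w :: "'a ^ 3"
    assume "(v, w) \<in> proj_rel"
    then obtain c where "v \<noteq> 0" "w \<noteq> 0" "c \<noteq> 0" "w = c *s v"
      by (auto simp: proj_rel_def)
    moreover from this have "v = inverse c *s w"
      by (simp add: vector_smult_assoc)
    ultimately show "(w, v) \<in> proj_rel"
      unfolding proj_rel_def using nonzero_imp_inverse_nonzero by blast
  qed
  show "trans (proj_rel :: ('a ^ 3) rel)"
  proof (rule transI)
    fix u v w :: "'a ^ 3"
    assume "(u, v) \<in> proj_rel" "(v, w) \<in> proj_rel"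
    then obtain c d where "u \<noteq> 0" "w \<noteq> 0" "c \<noteq> 0" "d \<noteq> 0" "v = c *s u" "w = d *s v"
      by (auto simp: proj_rel_def)
    moreover from this have "w = (d * c) *s u" "d * c \<noteq> 0"
      by (simp_all add: vector_smult_assoc)
    ultimately show "(u, w) \<in> proj_rel"
      unfolding proj_rel_def by blast
  qed
qed

lemma incident_proj_class:
  fixes a b :: "'a::field ^ 3"
  assumes "a \<noteq> 0" "b \<noteq> 0"
  shows "incident (proj_class a) (proj_class b) \<longleftrightarrow>
    a $ 1 * b $ 1 + a $ 2 * b $ 2 + a $ 3 * b $ 3 = 0"
proof
  assume "incident (proj_class a) (proj_class b)"
  moreover have "a \<in> proj_class a" "b \<in> proj_class b"
    using assms by (auto simp: proj_class_def proj_rel_def intro!: exI[of _ 1])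
  ultimately show "a $ 1 * b $ 1 + a $ 2 * b $ 2 + a $ 3 * b $ 3 = 0"
    by (auto simp: incident_def)
next
  assume *: "a $ 1 * b $ 1 + a $ 2 * b $ 2 + a $ 3 * b $ 3 = 0"
  have "(c * a $ 1) * (d * b $ 1) + (c * a $ 2) * (d * b $ 2) + (c * a $ 3) * (d * b $ 3) =
    c * d * (a $ 1 * b $ 1 + a $ 2 * b $ 2 + a $ 3 * b $ 3)" for c d
    by (simp add: algebra_simps)
  with * show "incident (proj_class a) (proj_class b)"
    by (auto simp: incident_def proj_class_def proj_rel_def)
qed

end

theory Submission
  imports Defs "HOL-Number_Theory.Cong"
begin

text \<open>
  Polarity in the conic turns passant lines into internal points, so the incidence matrix becomes a
  symmetric matrix \<open>A\<close> on the internal points: the entry at two points is \<open>1\<close> when they are conjugate.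
  Over \<open>F_2\<close> one has \<open>A\<^sup>3 = A\<close> (\<open>perp_cube\<close>). Hence \<open>A\<^sup>2\<close> is idempotent, the null space of \<open>A\<close> is the image of
  the complementary idempotent \<open>1 + A\<^sup>2\<close>, and the task is to find the rank of that idempotent.

  The rank of an idempotent is its trace, but over \<open>F_2\<close> this only gives the parity. The idempotent is
  therefore lifted to characteristic zero: an integer matrix \<open>G\<close> is exhibited that is congruent to
  \<open>1 + A\<^sup>2\<close> modulo \<open>2\<close> and satisfies \<open>G\<^sup>2 = c G\<close> with \<open>c\<close> odd. Reduction modulo \<open>2\<close> cannot increase the
  rank of \<open>G\<close>, nor that of \<open>c - G\<close>; since the two reductions are complementary, neither rank drops,
  and the dimension sought is the trace of \<open>G\<close> divided by \<open>c\<close> (\<open>dim_null_space_mod_2\<close>).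

  To construct \<open>G\<close>, normalize an internal point to a vector \<open>p\<close> whose discriminant is a fixed non-square
  \<open>n\<close>; it is determined up to sign and gives an anisotropic binary quadratic form on the projective line.
  The group \<open>PGL(2,q)\<close> acts on all this, and the functions on internal points split into a part
  generated by vectors fixed by a unipotent subgroup and a cuspidal part. The orbits of the unipotent
  subgroups are the sets of all \<open>p\<close> whose form takes a given value at a given point of the line.
  So the first part is governed by the kernel that counts the points where two forms agree, less one. Its
  square is computed from a single character sum over such an orbit (\<open>sum_agreement_fibre\<close>). Let \<open>F\<close> be half
  of the sum of this kernel over the two signs of a vector. If \<open>q = 3\<close> modulo \<open>4\<close>, then \<open>F\<^sup>2 = q F\<close>, and \<open>G = F\<close>
  with \<open>c = q\<close>. If \<open>q = 1\<close> modulo \<open>4\<close>, then \<open>F\<close> satisfies a cubic equation with the roots \<open>0\<close>, \<open>q\<close> and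
  \<open>(q + 1) / 2\<close>, and \<open>G = (F - q) (F - (q + 1) / 2)\<close> is the multiple of the cuspidal projection with
  \<open>c = q (q + 1) / 2\<close>. In both cases the trace gives \<open>(q - 1)\<^sup>2 / 4\<close>.
\<close>

section \<open>Ranks of integral idempotents modulo 2\<close>

(* On bit, these rules replace the ring operations by Boolean ones, where ring normalization fails. *)
declare add_bit_eq_xor [simp del] mult_bit_eq_and [simp del]

text \<open>Zero outside \<open>I\<close>, like the vectors of \<open>null_space\<close>.\<close>

definition column :: "'c set \<Rightarrow> ('c \<Rightarrow> 'c \<Rightarrow> int) \<Rightarrow> 'c \<Rightarrow> 'c \<Rightarrow> 'k::field" where
  "column I G j = (\<lambda>i. if i \<in> I then of_int (G i j) else 0)"

lemma fun_sum_apply: "(\<Sum>j\<in>S. f j) x = (\<Sum>j\<in>S. f j x)"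
  by (induction S rule: infinite_finite_induct) auto

text \<open>Independence of an indexed family, as opposed to that of its range, also forbids repetitions; columns
  of a matrix are naturally such a family.\<close>

lemma independent_family_iff:
  fixes f :: "'s \<Rightarrow> 'c \<Rightarrow> 'k::field"
  assumes "finite S"
  shows "inj_on f S \<and> fun_space.independent (f ` S) \<longleftrightarrow>
    (\<forall>u. (\<Sum>j\<in>S. fun_scale (u j) (f j)) = 0 \<longrightarrow> (\<forall>j\<in>S. u j = 0))" (is "?L \<longleftrightarrow> ?R")
proof
  assume L: ?L
  show ?R
  proof (intro allI impI ballI)
    fix u j assume u: "(\<Sum>j\<in>S. fun_scale (u j) (f j)) = 0" and j: "j \<in> S"
    have "(\<Sum>v\<in>f ` S. fun_scale (u (the_inv_into S f v)) v) = (\<Sum>j\<in>S. fun_scale (u j) (f j))"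
      using L by (subst sum.reindex) (auto simp: the_inv_into_f_f intro!: sum.cong)
    then have "u (the_inv_into S f (f j)) = 0"
      using L u j assms by (intro fun_space.independentD[of "f ` S" "f ` S" "\<lambda>v. u (the_inv_into S f v)" "f j"]) auto
    then show "u j = 0" using L j by (simp add: the_inv_into_f_f)
  qed
next
  assume R: ?R
  have inj: "inj_on f S"
  proof (rule inj_onI, rule ccontr)
    fix i j assume ij: "i \<in> S" "j \<in> S" "f i = f j" "i \<noteq> j"
    define u :: "'s \<Rightarrow> 'k" where "u = (\<lambda>k. if k = i then 1 else if k = j then - 1 else 0)"
    have "(\<Sum>k\<in>S. fun_scale (u k) (f k)) = (\<Sum>k\<in>{i, j}. fun_scale (u k) (f k))"
      using ij assms by (intro sum.mono_neutral_right) (auto simp: u_def fun_scale_def)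
    also have "\<dots> = 0" using ij by (auto simp: u_def fun_scale_def fun_eq_iff)
    finally have "u i = 0" using R ij by blast
    then show False by (simp add: u_def)
  qed
  moreover have "fun_space.independent (f ` S)"
  proof (rule fun_space.independent_if_scalars_zero)
    show "finite (f ` S)" using assms by simp
    fix g x assume g: "(\<Sum>x\<in>f ` S. fun_scale (g x) x) = 0" and x: "x \<in> f ` S"
    have "(\<Sum>j\<in>S. fun_scale (g (f j)) (f j)) = 0"
      using g inj by (simp add: sum.reindex)
    then have "\<forall>j\<in>S. g (f j) = 0" using R[rule_format, of "\<lambda>j. g (f j)"] by blast
    then show "g x = 0" using x by auto
  qed
  ultimately show ?L by blast
qed

lemma dim_family_eq_card:
  fixes f :: "'s \<Rightarrow> 'c \<Rightarrow> 'k::field"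
  assumes "finite I"
  obtains S where "S \<subseteq> I" "inj_on f S" "fun_space.independent (f ` S)"
    "f ` I \<subseteq> fun_space.span (f ` S)" "card S = fun_space.dim (f ` I)"
proof -
  obtain B where B: "B \<subseteq> f ` I" "fun_space.independent B" "f ` I \<subseteq> fun_space.span B"
      "card B = fun_space.dim (f ` I)"
    by (rule fun_space.basis_exists)
  from B(1) obtain S where "S \<subseteq> I" "inj_on f S" "B = f ` S"
    by (meson subset_image_inj)
  with B that show ?thesis by (metis card_image)
qed

text \<open>Choose a basis among the columns of \<open>G\<close>. The product of the matrix of basis columns with the matrix of
  coordinates of all columns is \<open>G\<close>; the product in the other order is \<open>c\<close> times the identity because \<open>G\<close>
  multiplies each of its own columns by \<open>c\<close>. The two products have the same trace.\<close>

lemma dim_columns_eq_trace: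
  fixes c :: int
  assumes fin: "finite I"
    and idem: "\<And>i j. i \<in> I \<Longrightarrow> j \<in> I \<Longrightarrow> (\<Sum>k\<in>I. G i k * G k j) = c * G i j"
    and c: "of_int c \<noteq> (0 :: 'k::field)"
  shows "of_int c * of_nat (fun_space.dim ((column I G :: 'c \<Rightarrow> 'c \<Rightarrow> 'k) ` I)) = (of_int (\<Sum>i\<in>I. G i i) :: 'k)"
proof -
  let ?f = "column I G :: 'c \<Rightarrow> 'c \<Rightarrow> 'k"
  obtain S where S: "S \<subseteq> I" "inj_on ?f S" "fun_space.independent (?f ` S)"
    "?f ` I \<subseteq> fun_space.span (?f ` S)" "card S = fun_space.dim (?f ` I)"
    using dim_family_eq_card[OF fin] .
  have finS: "finite S" using S(1) fin finite_subset by blast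
  have "\<exists>r. \<forall>j\<in>I. ?f j = (\<Sum>s\<in>S. fun_scale (r j s) (?f s))"
  proof -
    have "\<exists>r. ?f j = (\<Sum>s\<in>S. fun_scale (r s) (?f s))" if "j \<in> I" for j
    proof -
      have "?f j \<in> fun_space.span (?f ` S)" using S(4) that by blast
      then obtain u where "?f j = (\<Sum>v\<in>?f ` S. fun_scale (u v) v)"
        using finS by (auto simp: fun_space.span_finite)
      then have "?f j = (\<Sum>s\<in>S. fun_scale (u (?f s)) (?f s))"
        using S(2) by (simp add: sum.reindex)
      then show ?thesis by (rule exI[of _ "\<lambda>s. u (?f s)"])
    qed
    then show ?thesis by metis
  qed
  then obtain r where r: "\<And>j. j \<in> I \<Longrightarrow> ?f j = (\<Sum>s\<in>S. fun_scale (r j s) (?f s))" by blast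
  have coord: "(\<Sum>j\<in>I. of_int (G j s) * r j s) = of_int c" if s: "s \<in> S" for s
  proof -
    define u where "u t = (\<Sum>j\<in>I. of_int (G j s) * r j t) - (if t = s then of_int c else 0)" for t
    have "(\<Sum>t\<in>S. fun_scale (u t) (?f t)) = 0"
    proof
      fix i
      show "(\<Sum>t\<in>S. fun_scale (u t) (?f t)) i = 0 i"
      proof (cases "i \<in> I")
        case True
        have "(\<Sum>t\<in>S. fun_scale (u t) (?f t)) i =
            (\<Sum>t\<in>S. (\<Sum>j\<in>I. of_int (G j s) * r j t) * ?f t i) - (\<Sum>t\<in>S. (if t = s then of_int c else 0) * ?f t i)"
          by (simp add: fun_sum_apply fun_scale_def u_def algebra_simps sum_subtractf)
        also have "(\<Sum>t\<in>S. (if t = s then of_int c else 0) * ?f t i) = (\<Sum>t\<in>S. if t = s then of_int c * ?f t i else 0)"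
          by (rule sum.cong) auto
        also have "\<dots> = of_int c * ?f s i"
          using s finS by simp
        also have "(\<Sum>t\<in>S. (\<Sum>j\<in>I. of_int (G j s) * r j t) * ?f t i) = (\<Sum>j\<in>I. of_int (G j s) * (\<Sum>t\<in>S. r j t * ?f t i))"
          by (simp add: sum_distrib_left sum_distrib_right mult.assoc) (rule sum.swap)
        also have "\<dots> = (\<Sum>j\<in>I. of_int (G j s) * ?f j i)"
          by (rule sum.cong[OF refl]) (subst (2) r, auto simp: fun_sum_apply fun_scale_def)
        also have "\<dots> = of_int (\<Sum>j\<in>I. G i j * G j s)"
          using True by (simp add: column_def mult.commute)
        also have "(\<Sum>j\<in>I. G i j * G j s) = c * G i s"
          using True s S(1) by (intro idem) auto
        also have "of_int (c * G i s) = of_int c * ?f s i"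
          using True by (simp add: column_def)
        finally show ?thesis by simp
      qed (simp add: fun_sum_apply fun_scale_def column_def)
    qed
    then have "u s = 0"
      using iffD1[OF independent_family_iff[OF finS] conjI[OF S(2,3)]] s by blast
    then show ?thesis by (simp add: u_def)
  qed
  have "of_int (\<Sum>i\<in>I. G i i) = (\<Sum>j\<in>I. ?f j j)" by (simp add: column_def)
  also have "\<dots> = (\<Sum>j\<in>I. \<Sum>s\<in>S. r j s * ?f s j)"
    by (rule sum.cong[OF refl]) (subst r, auto simp: fun_sum_apply fun_scale_def)
  also have "\<dots> = (\<Sum>s\<in>S. \<Sum>j\<in>I. of_int (G j s) * r j s)"
    by (subst sum.swap) (simp add: column_def mult.commute)
  also have "\<dots> = of_int c * of_nat (card S)" by (simp add: coord)
  finally show ?thesis by (simp add: S(5))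
qed

lemma of_int_bit_eq_0_iff: "(of_int z :: bit) = 0 \<longleftrightarrow> even z"
proof -
  have "(of_int (2 * k) :: bit) = 0" "(of_int (2 * k + 1) :: bit) = 1" for k
    by (simp_all only: of_int_mult of_int_add of_int_numeral bit_2_eq_0) simp_all
  then show ?thesis by (metis evenE oddE one_neq_zero)
qed

text \<open>An integral relation between columns that are independent modulo \<open>2\<close> has even coefficients, can be halved,
  and by infinite descent is trivial. A rational relation becomes integral after clearing denominators.\<close>

lemma dim_columns_mod_2_le:
  assumes fin: "finite I"
  shows "fun_space.dim ((column I G :: 'c \<Rightarrow> 'c \<Rightarrow> bit) ` I) \<le> fun_space.dim ((column I G :: 'c \<Rightarrow> 'c \<Rightarrow> rat) ` I)"
proof -
  let ?f = "column I G :: 'c \<Rightarrow> 'c \<Rightarrow> bit" and ?g = "column I G :: 'c \<Rightarrow> 'c \<Rightarrow> rat"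
  obtain S where S: "S \<subseteq> I" "inj_on ?f S" "fun_space.independent (?f ` S)"
    "card S = fun_space.dim (?f ` I)"
    using dim_family_eq_card[OF fin] .
  have finS: "finite S" using S(1) fin finite_subset by blast
  have descent: "\<forall>z. (\<forall>i\<in>I. (\<Sum>j\<in>S. z j * G i j) = 0) \<longrightarrow> (\<forall>j\<in>S. 2 ^ k dvd z j)" for k :: nat
  proof (induction k)
    case (Suc k)
    show ?case
    proof (intro allI impI)
      fix z assume z: "\<forall>i\<in>I. (\<Sum>j\<in>S. z j * G i j) = 0"
      have "(\<Sum>j\<in>S. fun_scale (of_int (z j)) (?f j)) = 0"
      proof
        fix i
        have "(\<Sum>j\<in>S. fun_scale (of_int (z j)) (?f j)) i = (if i \<in> I then of_int (\<Sum>j\<in>S. z j * G i j) else 0)"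
          by (simp add: fun_sum_apply fun_scale_def column_def)
        then show "(\<Sum>j\<in>S. fun_scale (of_int (z j)) (?f j)) i = 0 i"
          using z by simp
      qed
      then have "\<forall>j\<in>S. (of_int (z j) :: bit) = 0"
        by (rule iffD1[OF independent_family_iff[OF finS] conjI[OF S(2,3)], rule_format, THEN ballI])
      then have half: "\<forall>j\<in>S. z j = 2 * (z j div 2)"
        by (metis of_int_bit_eq_0_iff dvd_mult_div_cancel)
      have "(\<Sum>j\<in>S. (z j div 2) * G i j) = 0" if "i \<in> I" for i
      proof -
        have "2 * (\<Sum>j\<in>S. (z j div 2) * G i j) = (\<Sum>j\<in>S. z j * G i j)"
          unfolding sum_distrib_left by (rule sum.cong) (use half in auto)
        then show ?thesis using z that by auto
      qed
      then have "\<forall>j\<in>S. 2 ^ k dvd z j div 2" using Suc.IH[rule_format, of "\<lambda>j. z j div 2"] by blast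
      then show "\<forall>j\<in>S. 2 ^ Suc k dvd z j"
        using half by (metis dvd_refl mult_dvd_mono power_Suc)
    qed
  qed simp
  have "\<forall>u. (\<Sum>j\<in>S. fun_scale (u j) (?g j)) = 0 \<longrightarrow> (\<forall>j\<in>S. u j = 0)"
  proof (intro allI impI ballI)
    fix u and s assume u: "(\<Sum>j\<in>S. fun_scale (u j) (?g j)) = 0" and s: "s \<in> S"
    define d where "d = (\<Prod>j\<in>S. snd (quotient_of (u j)))"
    have d: "d \<noteq> 0"
      unfolding d_def using finS quotient_of_denom_pos' by (auto simp: prod_zero_iff) (metis less_irrefl)
    have "\<exists>z. of_int z = of_int d * u j" if "j \<in> S" for j
    proof -
      have "snd (quotient_of (u j)) dvd d" unfolding d_def using finS that by (rule dvd_prodI)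
      then obtain e where e: "d = snd (quotient_of (u j)) * e" by (elim dvdE)
      have "u j = of_int (fst (quotient_of (u j))) / of_int (snd (quotient_of (u j)))"
        by (metis prod.collapse quotient_of_div)
      moreover have "snd (quotient_of (u j)) \<noteq> 0" using quotient_of_denom_pos'[of "u j"] by simp
      ultimately have "of_int d * u j = of_int (e * fst (quotient_of (u j)))"
        using e by (simp add: field_simps)
      then show ?thesis by metis
    qed
    then obtain z where z: "\<And>j. j \<in> S \<Longrightarrow> of_int (z j) = of_int d * u j" by metis
    have "(\<Sum>j\<in>S. z j * G i j) = 0" if i: "i \<in> I" for i
    proof -
      have "(of_int (\<Sum>j\<in>S. z j * G i j) :: rat) = of_int d * (\<Sum>j\<in>S. fun_scale (u j) (?g j)) i"
        using i z by (simp add: fun_sum_apply fun_scale_def column_def sum_distrib_left mult.assoc)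
      also have "\<dots> = 0" by (simp add: u)
      finally show ?thesis by (simp only: of_int_eq_0_iff)
    qed
    then have dv: "2 ^ k dvd z s" for k using descent[of k] s by blast
    have "z s = 0"
    proof (rule ccontr)
      assume nz: "z s \<noteq> 0"
      with dv[of "nat \<bar>z s\<bar>"] have "2 ^ nat \<bar>z s\<bar> \<le> \<bar>z s\<bar>"
        by (metis abs_ge_self dvd_imp_le_int abs_of_nonneg zero_le_numeral zero_le_power)
      moreover have "int (nat \<bar>z s\<bar>) < 2 ^ nat \<bar>z s\<bar>"
        by (metis of_nat_less_two_power)
      ultimately show False by simp
    qed
    then show "u s = 0" using z[OF s] d by simp
  qed
  then have ind: "inj_on ?g S" "fun_space.independent (?g ` S)"
    using independent_family_iff[OF finS, of ?g] by blast+
  obtain B where B: "B \<subseteq> ?g ` I" "?g ` I \<subseteq> fun_space.span B" "card B = fun_space.dim (?g ` I)"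
    by (rule fun_space.basis_exists)
  have "finite B" using B(1) fin finite_subset by blast
  then have "card (?g ` S) \<le> card B"
    using fun_space.independent_span_bound[OF _ ind(2)] B(2) S(1) by blast
  then show ?thesis using ind(1) S(4) B(3) by (simp add: card_image)
qed

lemma dim_columns_mod_2_le_trace:
  assumes fin: "finite I"
    and idem: "\<And>i j. i \<in> I \<Longrightarrow> j \<in> I \<Longrightarrow> (\<Sum>k\<in>I. G i k * G k j) = c * G i j"
    and c: "c > 0"
  shows "c * int (fun_space.dim ((column I G :: 'c \<Rightarrow> 'c \<Rightarrow> bit) ` I)) \<le> (\<Sum>i\<in>I. G i i)"
proof -
  have "(of_int (c * int (fun_space.dim ((column I G :: 'c \<Rightarrow> 'c \<Rightarrow> rat) ` I))) :: rat) = of_int (\<Sum>i\<in>I. G i i)"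
    using dim_columns_eq_trace[OF fin idem, where 'k = rat] c by simp
  then have "c * int (fun_space.dim ((column I G :: 'c \<Rightarrow> 'c \<Rightarrow> rat) ` I)) = (\<Sum>i\<in>I. G i i)"
    by (simp only: of_int_eq_iff)
  moreover have "c * int (fun_space.dim ((column I G :: 'c \<Rightarrow> 'c \<Rightarrow> bit) ` I)) \<le> c * int (fun_space.dim ((column I G :: 'c \<Rightarrow> 'c \<Rightarrow> rat) ` I))"
    using c dim_columns_mod_2_le[OF fin, of G] by simp
  ultimately show ?thesis by simp
qed

text \<open>The trace bounds from above the ranks modulo \<open>2\<close> of \<open>G\<close> and of \<open>c - G\<close>. Since \<open>c\<close> is odd, the columns of both
  together span the whole space, so both bounds are attained.\<close>

lemma dim_columns_mod_2_eq_trace: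
  assumes fin: "finite I"
    and idem: "\<And>i j. i \<in> I \<Longrightarrow> j \<in> I \<Longrightarrow> (\<Sum>k\<in>I. G i k * G k j) = c * G i j"
    and c: "c > 0" "odd c"
  shows "c * int (fun_space.dim ((column I G :: 'c \<Rightarrow> 'c \<Rightarrow> bit) ` I)) = (\<Sum>i\<in>I. G i i)"
proof -
  define G' where "G' i j = (if i = j then c else 0) - G i j" for i j
  let ?f = "column I G :: 'c \<Rightarrow> 'c \<Rightarrow> bit" and ?f' = "column I G' :: 'c \<Rightarrow> 'c \<Rightarrow> bit"
  have idem': "(\<Sum>k\<in>I. G' i k * G' k j) = c * G' i j" if ij: "i \<in> I" "j \<in> I" for i j
  proof -
    have "(\<Sum>k\<in>I. G' i k * G' k j) = (\<Sum>k\<in>I. (if i = k then c * G' k j else 0) - (if k = j then c * G i k else 0) + G i k * G k j)"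
      by (rule sum.cong) (auto simp: G'_def algebra_simps)
    also have "\<dots> = c * G' i j - c * G i j + c * G i j"
      using fin ij by (simp add: sum.distrib sum_subtractf idem)
    finally show ?thesis by simp
  qed
  have tr': "(\<Sum>i\<in>I. G' i i) = c * int (card I) - (\<Sum>i\<in>I. G i i)"
    by (simp add: G'_def sum_subtractf)
  have le: "c * int (fun_space.dim (?f ` I)) \<le> (\<Sum>i\<in>I. G i i)"
    by (rule dim_columns_mod_2_le_trace[OF fin idem c(1)])
  have le': "c * int (fun_space.dim (?f' ` I)) \<le> c * int (card I) - (\<Sum>i\<in>I. G i i)"
    unfolding tr'[symmetric] by (rule dim_columns_mod_2_le_trace[OF fin idem' c(1)])
  have "card I \<le> fun_space.dim (?f ` I) + fun_space.dim (?f' ` I)"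
  proof -
    obtain B where B: "B \<subseteq> ?f ` I" "?f ` I \<subseteq> fun_space.span B" "card B = fun_space.dim (?f ` I)"
      by (rule fun_space.basis_exists)
    obtain B' where B': "B' \<subseteq> ?f' ` I" "?f' ` I \<subseteq> fun_space.span B'" "card B' = fun_space.dim (?f' ` I)"
      by (rule fun_space.basis_exists)
    define e :: "'c \<Rightarrow> 'c \<Rightarrow> bit" where "e i = (\<lambda>j. if j = i then 1 else 0)" for i
    have fB: "finite (B \<union> B')" using B(1) B'(1) fin by (meson finite_UnI finite_imageI finite_subset)
    have "\<forall>u. (\<Sum>j\<in>I. fun_scale (u j) (e j)) = 0 \<longrightarrow> (\<forall>j\<in>I. u j = 0)"
    proof (intro allI impI ballI)
      fix u j assume "(\<Sum>j\<in>I. fun_scale (u j) (e j)) = 0" "j \<in> I"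
      then have "(\<Sum>k\<in>I. if k = j then u k else 0) = 0"
        by (auto simp: fun_eq_iff fun_sum_apply fun_scale_def e_def if_distrib[where f = "\<lambda>x. _ * x"]
            eq_commute[of j] cong: if_cong dest!: spec[of _ j])
      then show "u j = 0" using fin \<open>j \<in> I\<close> by simp
    qed
    then have ind: "inj_on e I" "fun_space.independent (e ` I)"
      using independent_family_iff[OF fin, of e] by blast+
    have "(of_int c :: bit) = 1" using c(2) of_int_bit_eq_0_iff[of c] by simp
    then have "e i = ?f i + ?f' i" if "i \<in> I" for i
      using that by (auto simp: fun_eq_iff e_def column_def G'_def)
    moreover have "?f i \<in> fun_space.span (B \<union> B')" "?f' i \<in> fun_space.span (B \<union> B')" if "i \<in> I" for i
      using that B(2) B'(2) fun_space.span_mono[of B "B \<union> B'"] fun_space.span_mono[of B' "B \<union> B'"] by blast+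
    ultimately have "e ` I \<subseteq> fun_space.span (B \<union> B')"
      by (auto intro: fun_space.span_add)
    then have "card (e ` I) \<le> card (B \<union> B')"
      using fun_space.independent_span_bound[OF fB ind(2)] by blast
    then show ?thesis using ind(1) B(3) B'(3) card_Un_le[of B B'] by (simp add: card_image)
  qed
  then have "c * int (card I) \<le> c * int (fun_space.dim (?f ` I) + fun_space.dim (?f' ` I))"
    using c by (intro mult_left_mono) auto
  with le le' show ?thesis by (simp add: algebra_simps)
qed

text \<open>If \<open>A x = 0\<close>, then \<open>x = (1 + A\<^sup>2) x\<close>, and \<open>A (1 + A\<^sup>2) = 0\<close> modulo \<open>2\<close>; so the null space of \<open>A\<close> is the
  column space of \<open>G\<close>.\<close>

lemma dim_null_space_mod_2:
  fixes A G :: "'c \<Rightarrow> 'c \<Rightarrow> int"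
  assumes fin: "finite I"
    and cube: "\<And>i j. i \<in> I \<Longrightarrow> j \<in> I \<Longrightarrow> [(\<Sum>k\<in>I. A i k * (\<Sum>l\<in>I. A k l * A l j)) = A i j] (mod 2)"
    and comp: "\<And>i j. i \<in> I \<Longrightarrow> j \<in> I \<Longrightarrow> [G i j = (if i = j then 1 else 0) + (\<Sum>k\<in>I. A i k * A k j)] (mod 2)"
    and idem: "\<And>i j. i \<in> I \<Longrightarrow> j \<in> I \<Longrightarrow> (\<Sum>k\<in>I. G i k * G k j) = c * G i j"
    and c: "c > 0" "odd c"
  shows "c * int (fun_space.dim (null_space I I (\<lambda>i j. of_int (A i j) :: bit))) = (\<Sum>i\<in>I. G i i)"
proof -
  let ?f = "column I G :: 'c \<Rightarrow> 'c \<Rightarrow> bit"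
  let ?N = "null_space I I (\<lambda>i j. of_int (A i j) :: bit)"
  have of_int_cong: "(of_int a :: bit) = of_int b" if "[a = b] (mod 2)" for a b
  proof -
    obtain k where "b = a + 2 * k" using \<open>[a = b] (mod 2)\<close> by (auto simp: cong_iff_lin)
    then show ?thesis by (simp only: of_int_mult of_int_add of_int_numeral bit_2_eq_0) simp
  qed
  have Gbit: "(of_int (G i j) :: bit) = (if i = j then 1 else 0) + (\<Sum>k\<in>I. of_int (A i k) * of_int (A k j))"
    if "i \<in> I" "j \<in> I" for i j
    using of_int_cong[OF comp[OF that]] by simp
  have "?N \<subseteq> fun_space.span (?f ` I)"
  proof
    fix x assume x: "x \<in> ?N"
    have "x = (\<Sum>j\<in>I. fun_scale (x j) (?f j))"
    proof
      fix i
      show "x i = (\<Sum>j\<in>I. fun_scale (x j) (?f j)) i"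
      proof (cases "i \<in> I")
        case True
        have "(\<Sum>j\<in>I. fun_scale (x j) (?f j)) i = (\<Sum>j\<in>I. x j * of_int (G i j))"
          using True by (simp add: fun_sum_apply fun_scale_def column_def)
        also have "\<dots> = (\<Sum>j\<in>I. (if i = j then x j else 0) + (\<Sum>k\<in>I. of_int (A i k) * (of_int (A k j) * x j)))"
          using True by (intro sum.cong refl) (auto simp: Gbit distrib_left sum_distrib_left mult_ac)
        also have "\<dots> = x i + (\<Sum>k\<in>I. of_int (A i k) * (\<Sum>j\<in>I. of_int (A k j) * x j))"
          using True fin by (simp add: sum.distrib sum_distrib_left) (rule sum.swap)
        also have "\<dots> = x i" using x by (simp add: null_space_def)
        finally show ?thesis by simp
      next
        case False
        then show ?thesis using x by (simp add: null_space_def fun_sum_apply fun_scale_def column_def)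
      qed
    qed
    also have "\<dots> \<in> fun_space.span (?f ` I)"
      by (intro fun_space.span_sum fun_space.span_scale fun_space.span_base) auto
    finally show "x \<in> fun_space.span (?f ` I)" .
  qed
  moreover have "?f ` I \<subseteq> ?N"
  proof clarify
    fix j assume j: "j \<in> I"
    have "(\<Sum>k\<in>I. of_int (A i k) * ?f j k) = 0" if i: "i \<in> I" for i
    proof -
      have "(\<Sum>k\<in>I. of_int (A i k) * ?f j k) =
          (\<Sum>k\<in>I. (if k = j then of_int (A i k) else 0) + of_int (A i k * (\<Sum>l\<in>I. A k l * A l j)))"
        using j by (intro sum.cong refl) (auto simp: column_def Gbit distrib_left)
      also have "\<dots> = of_int (A i j) + of_int (\<Sum>k\<in>I. A i k * (\<Sum>l\<in>I. A k l * A l j))"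
        using j fin by (simp add: sum.distrib)
      also have "\<dots> = 0" using of_int_cong[OF cube[OF i j]] by (cases "of_int (A i j) :: bit") (auto simp: add_bit_eq_xor)
      finally show ?thesis .
    qed
    then show "?f j \<in> ?N" by (simp add: null_space_def column_def)
  qed
  ultimately have "fun_space.span (?f ` I) = fun_space.span ?N"
    by (metis fun_space.span_minimal fun_space.subspace_span fun_space.span_eq_iff subspace_null_space subset_antisym)
  then have "fun_space.dim ?N = fun_space.dim (?f ` I)"
    by (metis fun_space.span_eq_dim)
  then show ?thesis using dim_columns_mod_2_eq_trace[OF fin idem c] by simp
qed

section \<open>The quadratic character of a finite field of odd order\<close>

text \<open>Parities of sums are obtained below by pairing the terms under an involution without fixed points.\<close>

lemma involution_half_system:
  assumes "finite A" and "\<And>x. x \<in> A \<Longrightarrow> f x \<in> A" "\<And>x. x \<in> A \<Longrightarrow> f (f x) = x" "\<And>x. x \<in> A \<Longrightarrow> f x \<noteq> x"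
  obtains B where "B \<inter> f ` B = {}" "A = B \<union> f ` B" "inj_on f B"
proof -
  have "\<exists>B. B \<inter> f ` B = {} \<and> A = B \<union> f ` B"
    using assms
  proof (induction A rule: finite_psubset_induct)
    case (psubset A)
    show ?case
    proof (cases "A = {}")
      case False
      then obtain a where a: "a \<in> A" by blast
      define A' where "A' = A - {a, f a}"
      have "A' \<subset> A" using a by (auto simp: A'_def)
      moreover have "f x \<in> A'" if "x \<in> A'" for x
        using that psubset.prems a unfolding A'_def by (metis Diff_iff insert_iff empty_iff)
      moreover have "f (f x) = x" "f x \<noteq> x" if "x \<in> A'" for x
        using that psubset.prems by (auto simp: A'_def)
      ultimately obtain B where B: "B \<inter> f ` B = {}" "A' = B \<union> f ` B"
        using psubset.IH[of A'] by blast
      have "a \<notin> A'" "f a \<notin> A'" by (auto simp: A'_def)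
      then have "insert a B \<inter> f ` insert a B = {}"
        using B psubset.prems(3)[OF a] by auto
      moreover have "A = insert a B \<union> f ` insert a B"
        using B a psubset.prems(1)[OF a] by (auto simp: A'_def)
      ultimately show ?thesis by blast
    qed auto
  qed
  then obtain B where B: "B \<inter> f ` B = {}" "A = B \<union> f ` B" by blast
  moreover have "inj_on f B"
    by (rule inj_on_inverseI[of _ f]) (use assms(3) B in blast)
  ultimately show ?thesis by (rule that)
qed

lemma even_sum_involution:
  fixes h :: "'b \<Rightarrow> int"
  assumes "finite A" and "\<And>x. x \<in> A \<Longrightarrow> f x \<in> A" "\<And>x. x \<in> A \<Longrightarrow> f (f x) = x" "\<And>x. x \<in> A \<Longrightarrow> f x \<noteq> x"
    and "\<And>x. x \<in> A \<Longrightarrow> h (f x) = h x"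
  shows "even (\<Sum>x\<in>A. h x)"
proof -
  obtain B where B: "B \<inter> f ` B = {}" "A = B \<union> f ` B" "inj_on f B"
    using involution_half_system[of A f] assms(1-4) by blast
  have "(\<Sum>x\<in>A. h x) = (\<Sum>x\<in>B. h x) + (\<Sum>x\<in>f ` B. h x)"
    unfolding B(2) using B(1) assms(1) B(2) by (intro sum.union_disjoint) auto
  also have "(\<Sum>x\<in>f ` B. h x) = (\<Sum>x\<in>B. h x)"
    using B by (subst sum.reindex) (auto intro!: sum.cong assms(5))
  finally show ?thesis by simp
qed

definition quad_char :: "'a::field \<Rightarrow> int" where
  "quad_char x = (if x = 0 then 0 else if \<exists>y. x = y\<^sup>2 then 1 else - 1)"

lemma quad_char_0 [simp]: "quad_char 0 = 0"
  by (simp add: quad_char_def)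

lemma quad_char_eq_0_iff [simp]: "quad_char x = 0 \<longleftrightarrow> x = 0"
  by (simp add: quad_char_def)

lemma quad_char_square: "x \<noteq> 0 \<Longrightarrow> quad_char (x\<^sup>2) = 1"
  by (auto simp: quad_char_def)

lemma quad_char_mult_self: "x \<noteq> 0 \<Longrightarrow> quad_char x * quad_char x = 1"
  by (simp add: quad_char_def)

lemma quad_char_1 [simp]: "quad_char 1 = 1"
  using quad_char_square[of 1] by simp

lemma quad_char_le_1: "quad_char x \<le> 1"
  by (simp add: quad_char_def)

lemma quad_char_cases:
  obtains "x = 0" "quad_char x = 0" | "x \<noteq> 0" "quad_char x = 1" | "x \<noteq> 0" "quad_char x = - 1"
  by (cases "x = 0"; cases "\<exists>y. x = y\<^sup>2") (auto simp: quad_char_def)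

lemma quad_char_square_mult: "y \<noteq> 0 \<Longrightarrow> quad_char (y\<^sup>2 * x) = quad_char (x :: 'a::field)"
proof -
  assume y: "y \<noteq> 0"
  have "(\<exists>z. y\<^sup>2 * x = z\<^sup>2) \<longleftrightarrow> (\<exists>z. x = z\<^sup>2)"
  proof
    assume "\<exists>z. y\<^sup>2 * x = z\<^sup>2"
    then obtain z where "y\<^sup>2 * x = z\<^sup>2" by blast
    then have "x = (z / y)\<^sup>2" using y by (simp add: power_divide field_simps)
    then show "\<exists>z. x = z\<^sup>2" by blast
  qed (auto simp: power_mult_distrib[symmetric])
  then show ?thesis using y by (simp add: quad_char_def)
qed

locale odd_finite_field =
  fixes ty :: "'a::{field,finite} itself"
  assumes odd_card: "odd CARD('a)"
begin

lemma two_neq_0: "(2 :: 'a) \<noteq> 0"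
proof
  assume "(2 :: 'a) = 0"
  then have "x + 1 + 1 = x" for x :: 'a by (simp add: add.assoc)
  then have "even (\<Sum>x\<in>(UNIV :: 'a set). 1 :: int)"
    by (intro even_sum_involution[where f = "\<lambda>x. x + 1"]) auto
  then show False using odd_card by simp
qed

lemma four_neq_0: "(4 :: 'a) \<noteq> 0"
  using two_neq_0 mult_eq_0_iff[of "2 :: 'a" 2] by simp

lemma neg_neq: "x \<noteq> 0 \<Longrightarrow> - x \<noteq> (x :: 'a)"
  using two_neq_0 by (metis add.inverse_inverse add_eq_0_iff mult_2 mult_eq_0_iff)

lemma card_square_roots: "int (card {x :: 'a. x\<^sup>2 = a}) = 1 + quad_char a"
proof -
  consider "a = 0" | y where "a \<noteq> 0" "a = y\<^sup>2" | "\<nexists>y. a = y\<^sup>2" by blast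
  then show ?thesis
  proof cases
    case 2
    then have "{x. x\<^sup>2 = a} = {y, - y}" by (auto simp: power2_eq_iff)
    moreover have "y \<noteq> - y" using neg_neq[of y] 2 by auto
    ultimately show ?thesis using 2 by (auto simp: quad_char_def)
  next
    case 3
    then have "{x. x\<^sup>2 = a} = {}" by auto
    moreover have "a \<noteq> 0" using 3 by (metis zero_power2)
    ultimately show ?thesis using 3 by (simp add: quad_char_def)
  qed simp
qed

lemma sum_square_roots:
  fixes h :: "'b \<Rightarrow> 'a"
  assumes "finite A"
  shows "int (card {(x, t). t \<in> A \<and> x\<^sup>2 = h t}) = (\<Sum>t\<in>A. 1 + quad_char (h t))"
proof -
  have "{(x, t). t \<in> A \<and> x\<^sup>2 = h t} = prod.swap ` (SIGMA t:A. {x. x\<^sup>2 = h t})"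
    by (auto simp: image_iff)
  then have "card {(x, t). t \<in> A \<and> x\<^sup>2 = h t} = (\<Sum>t\<in>A. card {x. x\<^sup>2 = h t})"
    using assms by (simp add: card_image inj_on_def)
  then show ?thesis by (simp add: card_square_roots)
qed

lemma sum_quad_char: "(\<Sum>x\<in>UNIV. quad_char (x :: 'a)) = 0"
proof -
  have "{(x, t). t \<in> (UNIV :: 'a set) \<and> x\<^sup>2 = t} = (\<lambda>x. (x, x\<^sup>2)) ` UNIV" by auto
  then have "card {(x, t). t \<in> (UNIV :: 'a set) \<and> x\<^sup>2 = t} = CARD('a)"
    by (simp add: card_image inj_on_def)
  then show ?thesis using sum_square_roots[of UNIV "\<lambda>t. t"] by (simp add: sum.distrib)
qed

lemma quad_char_mult: "quad_char (a * b) = quad_char a * quad_char (b :: 'a)"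
proof -
  have sq: "quad_char (a * b) = quad_char b" if a: "quad_char a = 1" for a b :: 'a
  proof -
    obtain y where "a = y\<^sup>2" "y \<noteq> 0" using a by (auto simp: quad_char_def split: if_splits)
    then show ?thesis by (simp add: quad_char_square_mult)
  qed
  show ?thesis
  proof (cases a rule: quad_char_cases)
    case 3
    have le: "quad_char (a * x) + quad_char x \<le> 0" for x
      using sq[of x a] 3 quad_char_le_1[of "a * x"] by (cases x rule: quad_char_cases) (auto simp: mult.commute)
    have "(\<Sum>x\<in>UNIV. quad_char (a * x)) = (\<Sum>x\<in>UNIV. quad_char (x :: 'a))"
      by (rule sum.reindex_bij_witness[of _ "\<lambda>x. x / a" "\<lambda>x. a * x"]) (use 3 in auto)
    then have "(\<Sum>x\<in>UNIV. - (quad_char (a * x) + quad_char x)) = 0"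
      by (simp add: sum_subtractf sum_quad_char sum_negf)
    \<comment> \<open>For a non-square \<open>a\<close> these terms are nonnegative and add up to zero, so each vanishes.\<close>
    moreover have "0 \<le> - (quad_char (a * x) + quad_char x)" for x
      using le[of x] by linarith
    ultimately have "- (quad_char (a * b) + quad_char b) = 0"
      using sum_nonneg_eq_0_iff[of UNIV "\<lambda>x. - (quad_char (a * x) + quad_char x)"] by auto
    then show ?thesis using 3 by simp
  qed (simp_all add: sq)
qed

lemma quad_char_divide: "quad_char (a / b) = quad_char a * quad_char (b :: 'a)"
proof (cases "b = 0")
  case False
  then have "quad_char (a / b) = quad_char (b\<^sup>2 * (a / b))" by (simp only: quad_char_square_mult[OF False])
  also have "b\<^sup>2 * (a / b) = a * b" using False by (simp add: power2_eq_square)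
  finally show ?thesis by (simp add: quad_char_mult)
qed simp

text \<open>The solutions of \<open>s\<^sup>2 = t\<^sup>2 - d\<close> correspond to the factorizations \<open>(t - s) (t + s) = d\<close>.\<close>

lemma sum_quad_char_square_minus:
  "(\<Sum>t\<in>UNIV. quad_char (t\<^sup>2 - d)) = (if d = 0 then int CARD('a) else 0) - (1 :: int)" for d :: 'a
proof (cases "d = 0")
  case True
  have "(\<Sum>t\<in>UNIV. quad_char (t\<^sup>2 :: 'a)) = (\<Sum>t\<in>UNIV - {0 :: 'a}. 1)"
    by (rule sum.mono_neutral_cong_right) (auto simp: quad_char_square)
  then show ?thesis using True by (simp add: card_Diff_singleton of_nat_diff)
next
  case False
  define X where "X = {(s, t). t \<in> (UNIV :: 'a set) \<and> s\<^sup>2 = t\<^sup>2 - d}"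
  have "bij_betw (\<lambda>u. ((d / u - u) / 2, (d / u + u) / 2)) (UNIV - {0}) X"
  proof (rule bij_betw_byWitness[where f' = "\<lambda>(s, t). t - s"])
    show "\<forall>u\<in>UNIV - {0}. (case ((d / u - u) / 2, (d / u + u) / 2) of (s, t) \<Rightarrow> t - s) = u"
      using two_neq_0 four_neq_0 by (auto simp: field_simps)
    have split: "(t - s) * (t + s) = d" if "(s, t) \<in> X" for s t
      using that by (auto simp: X_def algebra_simps power2_eq_square)
    show "\<forall>x\<in>X. (\<lambda>u. ((d / u - u) / 2, (d / u + u) / 2)) (case x of (s, t) \<Rightarrow> t - s) = x"
    proof
      fix x assume "x \<in> X"
      obtain s t where x: "x = (s, t)" by (cases x)
      with \<open>x \<in> X\<close> have X: "(s, t) \<in> X" by simp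
      have "t - s \<noteq> 0" using split[OF X] False by auto
      then have "d / (t - s) = t + s" using split[OF X] by (simp add: field_simps)
      then show "(\<lambda>u. ((d / u - u) / 2, (d / u + u) / 2)) (case x of (s, t) \<Rightarrow> t - s) = x"
        using two_neq_0 by (simp add: x)
    qed
    show "(\<lambda>u. ((d / u - u) / 2, (d / u + u) / 2)) ` (UNIV - {0}) \<subseteq> X"
      using two_neq_0 four_neq_0 by (auto simp: X_def field_simps power2_eq_square)
    show "(\<lambda>(s, t). t - s) ` X \<subseteq> UNIV - {0}"
      using split False by fastforce
  qed
  then have "int (card X) = int CARD('a) - 1"
    by (simp add: bij_betw_same_card[symmetric] card_Diff_singleton of_nat_diff)
  then show ?thesis
    using sum_square_roots[of UNIV "\<lambda>t. t\<^sup>2 - d"] False by (simp add: X_def sum.distrib)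
qed

text \<open>There are \<open>(q - 1) / 2\<close> nonzero squares. If \<open>-1\<close> is a square, they are paired by negation; otherwise
  inversion pairs all of them except \<open>1\<close>.\<close>

lemma quad_char_minus_1: "quad_char (- 1 :: 'a) = (if CARD('a) mod 4 = 1 then 1 else - 1)"
proof -
  define S where "S = {x :: 'a. quad_char x = 1}"
  have "2 * int (card S) = (\<Sum>x\<in>UNIV. (1 + quad_char (x :: 'a)) - (if x = 0 then 1 else 0))"
  proof -
    have "(\<Sum>x\<in>UNIV. (1 + quad_char (x :: 'a)) - (if x = 0 then 1 else 0)) = (\<Sum>x\<in>S. 2)"
    proof (rule sum.mono_neutral_cong_right)
      show "\<forall>i\<in>UNIV - S. 1 + quad_char (i :: 'a) - (if i = 0 then 1 else 0) = 0"
      proof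
        fix x :: 'a assume "x \<in> UNIV - S"
        then show "1 + quad_char x - (if x = 0 then 1 else 0) = 0"
          by (cases x rule: quad_char_cases) (auto simp: S_def)
      qed
    qed (auto simp: S_def)
    then show ?thesis by simp
  qed
  also have "\<dots> = int CARD('a) - 1"
    by (simp add: sum.distrib sum_subtractf sum_quad_char)
  finally have cS: "2 * int (card S) = int CARD('a) - 1" .
  show ?thesis
  proof (cases "quad_char (- 1 :: 'a) = 1")
    case True
    have "even (\<Sum>x\<in>S. 1 :: int)"
    proof (rule even_sum_involution[where f = uminus])
      fix x assume "x \<in> S"
      then have "x \<noteq> 0" by (auto simp: S_def)
      with \<open>x \<in> S\<close> show "- x \<in> S" "- x \<noteq> x"
        using True quad_char_mult[of "- 1" x] neg_neq[of x] by (auto simp: S_def)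
    qed auto
    then have "even (int (card S))" by simp
    then obtain k where "int (card S) = 2 * k" by blast
    with cS have "int CARD('a) = 4 * k + 1" by simp
    then have "CARD('a) mod 4 = 1" by presburger
    then show ?thesis using True by simp
  next
    case False
    then have m1: "quad_char (- 1 :: 'a) = - 1" by (cases "- 1 :: 'a" rule: quad_char_cases) auto
    have "even (\<Sum>x\<in>S - {1}. 1 :: int)"
    proof (rule even_sum_involution[where f = inverse])
      fix x assume x: "x \<in> S - {1}"
      then have x0: "x \<noteq> 0" by (auto simp: S_def)
      show "inverse x \<in> S - {1}"
        using x quad_char_divide[of 1 x] by (auto simp: S_def inverse_eq_divide)
      show "inverse x \<noteq> x"
      proof
        assume "inverse x = x"
        then have "x\<^sup>2 = 1" using x0 by (metis power2_eq_square right_inverse)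
        then show False using x m1 by (auto simp: power2_eq_1_iff S_def)
      qed
    qed auto
    moreover have "1 \<in> S" by (simp add: S_def)
    ultimately have "odd (int (card S))" by (simp add: card_Diff_singleton of_nat_diff Suc_leI card_gt_0_iff) (metis card_gt_0_iff empty_iff even_Suc finite Suc_pred)
    then obtain k where "int (card S) = 2 * k + 1" by (auto elim: oddE)
    with cS have "int CARD('a) = 4 * k + 3" by simp
    then have "CARD('a) mod 4 = 3" by presburger
    then show ?thesis using m1 by simp
  qed
qed

end

section \<open>Points of the plane as binary quadratic forms\<close>

text \<open>A vector is identified with the binary quadratic form whose coefficients are its coordinates, the middle
  one doubled. The conic is then the zero set of the discriminant.\<close>

definition disc :: "'a::field ^ 3 \<Rightarrow> 'a" where
  "disc p = (p $ 2)\<^sup>2 - p $ 1 * p $ 3"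

text \<open>This is the polarization \<open>disc (p + r) - disc p - disc r\<close> itself and not half of it; the values on the
  diagonal are \<open>2 * disc p\<close>.\<close>

definition polar :: "'a::field ^ 3 \<Rightarrow> 'a ^ 3 \<Rightarrow> 'a" where
  "polar p r = 2 * p $ 2 * r $ 2 - p $ 1 * r $ 3 - p $ 3 * r $ 1"

fun binary_form :: "'a::field ^ 3 \<Rightarrow> 'a \<times> 'a \<Rightarrow> 'a" where
  "binary_form p (x, y) = p $ 1 * x\<^sup>2 + 2 * p $ 2 * x * y + p $ 3 * y\<^sup>2"

declare binary_form.simps [simp del]

text \<open>One representative for each point of the projective line over the field.\<close>

definition proj_line :: "('a::field \<times> 'a) set" where
  "proj_line = insert (1, 0) (range (\<lambda>s. (s, 1)))"

lemma disc_diff: "disc (p - r) = disc p + disc r - polar p r"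
  and disc_add: "disc (p + r) = disc p + disc r + polar p r"
  and disc_minus [simp]: "disc (- p) = disc p"
  and disc_0 [simp]: "disc 0 = 0"
  and disc_scale: "disc (c *s p) = c\<^sup>2 * disc p"
  by (simp_all add: disc_def polar_def power2_eq_square algebra_simps)

lemma polar_commute: "polar p r = polar r p"
  and polar_self: "polar p p = 2 * disc p"
  and polar_minus_left [simp]: "polar (- p) r = - polar p r"
  and polar_minus_right [simp]: "polar p (- r) = - polar p r"
  and polar_add_left: "polar (p + p') r = polar p r + polar p' r"
  and polar_diff_left: "polar (p - p') r = polar p r - polar p' r"
  and polar_scale_left: "polar (c *s p) r = c * polar p r"
  by (simp_all add: disc_def polar_def power2_eq_square algebra_simps)

lemma binary_form_minus [simp]: "binary_form (- p) l = - binary_form p l"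
  and binary_form_diff: "binary_form (p - r) l = binary_form p l - binary_form r l"
  by (cases l; simp add: binary_form.simps algebra_simps)+

lemma sum_proj_line:
  fixes f :: "'a::{field,finite} \<times> 'a \<Rightarrow> 'b::comm_monoid_add"
  shows "(\<Sum>l\<in>proj_line. f l) = f (1, 0) + (\<Sum>s\<in>UNIV. f (s, 1))"
proof -
  have "(\<Sum>l\<in>proj_line. f l) = f (1, 0) + (\<Sum>l\<in>range (\<lambda>s. (s, 1)). f l)"
    unfolding proj_line_def by (rule sum.insert) auto
  then show ?thesis by (simp add: sum.reindex inj_on_def)
qed

locale nonsplit_quadric = odd_finite_field ty for ty :: "'a::{field,finite} itself" +
  fixes n :: 'a and q :: int
  assumes n_nonsquare: "quad_char n = - 1" and int_card [simp]: "int CARD('a) = q"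
begin

definition quadric :: "('a ^ 3) set" where
  "quadric = {p. disc p = n}"

lemma n_neq_0: "n \<noteq> 0"
  using n_nonsquare by auto

lemma not_square_n: "n \<noteq> x\<^sup>2"
  using n_nonsquare by (auto simp: quad_char_def split: if_splits)

lemma uminus_quadric: "p \<in> quadric \<Longrightarrow> - p \<in> quadric"
  by (simp add: quadric_def)

lemma quadric_neq_0: "p \<in> quadric \<Longrightarrow> p \<noteq> 0"
  using n_neq_0 by (auto simp: quadric_def)

lemma uminus_quadric_neq: "p \<in> quadric \<Longrightarrow> - p \<noteq> p"
proof
  assume p: "p \<in> quadric" "- p = p"
  then have "- (p $ i) = p $ i" for i by (metis vector_uminus_component)
  then have "p $ i = 0" for i using neg_neq by blast
  then show False using quadric_neq_0[OF p(1)] by (simp add: vec_eq_iff)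
qed

lemma binary_form_neq_0:
  assumes "p \<in> quadric" "(x, y) \<noteq> (0, 0)"
  shows "binary_form p (x, y) \<noteq> 0"
proof
  assume 0: "binary_form p (x, y) = 0"
  have "(p $ 1 * x + p $ 2 * y)\<^sup>2 = p $ 1 * binary_form p (x, y) + disc p * y\<^sup>2"
    by (simp add: disc_def binary_form.simps power2_eq_square algebra_simps)
  then have 1: "(p $ 1 * x + p $ 2 * y)\<^sup>2 = n * y\<^sup>2" using 0 assms by (simp add: quadric_def)
  have "y = 0"
  proof (rule ccontr)
    assume "y \<noteq> 0"
    with 1 have "n = ((p $ 1 * x + p $ 2 * y) / y)\<^sup>2" by (simp add: power_divide)
    then show False using not_square_n by blast
  qed
  then have "p $ 1 = 0" using 1 assms(2) by simp
  then have "n = (p $ 2)\<^sup>2" using assms by (simp add: quadric_def disc_def)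
  then show False using not_square_n by blast
qed

lemma binary_form_proj_line_neq_0: "p \<in> quadric \<Longrightarrow> l \<in> proj_line \<Longrightarrow> binary_form p l \<noteq> 0"
  using binary_form_neq_0 by (auto simp: proj_line_def)

text \<open>An isotropic vector is, up to a factor, the vector of squares and products of some \<open>(x, y)\<close>, and pairing \<open>p\<close>
  with it evaluates the form of \<open>p\<close> at \<open>(x, y)\<close>. Geometrically: an internal point lies on no tangent.\<close>

lemma polar_isotropic_neq_0:
  assumes p: "p \<in> quadric" and w: "w \<noteq> 0" "disc w = 0"
  shows "polar p w \<noteq> 0"
proof
  assume pw: "polar p w = 0"
  have w0: "(w $ 2)\<^sup>2 = w $ 1 * w $ 3" using w by (simp add: disc_def)
  have "w $ 1 * polar p w = - binary_form p (w $ 2, - (w $ 1))"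
    using w0 by (simp add: polar_def binary_form.simps power2_eq_square algebra_simps)
  then have "w $ 1 = 0" using pw binary_form_neq_0[OF p, of "w $ 2" "- (w $ 1)"] by auto
  moreover from this have "w $ 2 = 0" using w0 by simp
  moreover have "p $ 1 \<noteq> 0" using binary_form_neq_0[OF p, of 1 0] by (simp add: binary_form.simps)
  ultimately have "w $ 1 = 0" "w $ 2 = 0" "w $ 3 = 0" using pw by (auto simp: polar_def)
  then show False using w by (simp add: vec_eq_iff forall_3)
qed

lemma disc_diff_eq_0:
  assumes p: "p \<in> quadric" and r: "r \<in> quadric" and 0: "disc (p - r) = 0"
  shows "p = r"
proof (rule ccontr)
  assume "p \<noteq> r"
  have "disc r = disc p + disc (p - r) - polar p (p - r)" by (simp flip: disc_diff)
  then have "polar p (p - r) = 0" using p r 0 by (simp add: quadric_def)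
  then show False using polar_isotropic_neq_0[OF p _ 0] \<open>p \<noteq> r\<close> by simp
qed

lemma card_binary_form_zeros:
  fixes v :: "'a ^ 3"
  shows "(\<Sum>l\<in>proj_line. if binary_form v l = 0 then 1 else 0) = 1 + quad_char (disc v) + (if v = 0 then q else 0)"
proof -
  have *: "(\<Sum>l\<in>proj_line. if binary_form v l = 0 then 1 else 0) =
      (if v $ 1 = 0 then 1 else 0) + int (card {s. v $ 1 * s\<^sup>2 + 2 * v $ 2 * s + v $ 3 = 0})"
    by (simp add: sum_proj_line binary_form.simps sum.If_cases)
  show ?thesis
  proof (cases "v $ 1 = 0")
    case False
    have "bij_betw (\<lambda>s. v $ 1 * s + v $ 2) {s. v $ 1 * s\<^sup>2 + 2 * v $ 2 * s + v $ 3 = 0} {x. x\<^sup>2 = disc v}"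
    proof (rule bij_betw_byWitness[where f' = "\<lambda>x. (x - v $ 2) / v $ 1"])
      have key: "(v $ 1 * s + v $ 2)\<^sup>2 = v $ 1 * (v $ 1 * s\<^sup>2 + 2 * v $ 2 * s + v $ 3) + disc v" for s
        by (simp add: disc_def power2_eq_square algebra_simps)
      show "(\<lambda>s. v $ 1 * s + v $ 2) ` {s. v $ 1 * s\<^sup>2 + 2 * v $ 2 * s + v $ 3 = 0} \<subseteq> {x. x\<^sup>2 = disc v}"
        by (auto simp: key)
      show "(\<lambda>x. (x - v $ 2) / v $ 1) ` {x. x\<^sup>2 = disc v} \<subseteq> {s. v $ 1 * s\<^sup>2 + 2 * v $ 2 * s + v $ 3 = 0}"
      proof clarify
        fix x assume x: "x\<^sup>2 = disc v"
        have "v $ 1 * ((x - v $ 2) / v $ 1) + v $ 2 = x" using False by simp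
        then show "v $ 1 * ((x - v $ 2) / v $ 1)\<^sup>2 + 2 * v $ 2 * ((x - v $ 2) / v $ 1) + v $ 3 = 0"
          using key[of "(x - v $ 2) / v $ 1"] x False by simp
      qed
    qed (use False in auto)
    then show ?thesis using * False card_square_roots[of "disc v"] by (auto simp: bij_betw_same_card)
  next
    case True
    then have d: "disc v = (v $ 2)\<^sup>2" by (simp add: disc_def)
    show ?thesis
    proof (cases "v $ 2 = 0")
      case False
      then have "{s. v $ 1 * s\<^sup>2 + 2 * v $ 2 * s + v $ 3 = 0} = {- v $ 3 / (2 * v $ 2)}"
        using True two_neq_0 by (auto simp: field_simps add_eq_0_iff)
      then show ?thesis using * True False by (auto simp: d quad_char_square)
    next
      case v2: True
      have "v = 0 \<longleftrightarrow> v $ 3 = 0" using True v2 by (simp add: vec_eq_iff forall_3)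
      then show ?thesis using * True v2 by (auto simp: d)
    qed
  qed
qed

section \<open>The agreement kernel\<close>

text \<open>One less than the number of points of the projective line where the forms \<open>p\<close> and \<open>r\<close> agree, by
  \<open>agreement_eq_sum\<close> below.\<close>

definition agreement :: "'a ^ 3 \<Rightarrow> 'a ^ 3 \<Rightarrow> int" where
  "agreement p r = quad_char (disc (p - r)) + (if p = r then q else 0)"

text \<open>The correction term in the square of the agreement kernel. Its columns are
  combinations of the sign functions \<open>r \<mapsto> quad_char (binary_form r l)\<close>, on which the agreement kernel acts as a
  scalar.\<close>

definition sign_correlation :: "'a ^ 3 \<Rightarrow> 'a ^ 3 \<Rightarrow> int" where
  "sign_correlation p r = (\<Sum>l\<in>proj_line. quad_char (binary_form p l * binary_form r l))"

lemma agreement_eq_sum: "agreement p r = (\<Sum>l\<in>proj_line. if binary_form p l = binary_form r l then 1 else 0) - 1"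
  using card_binary_form_zeros[of "p - r"] by (simp add: agreement_def binary_form_diff)

text \<open>The vectors on the quadric whose form takes the value \<open>\<gamma>\<close> at \<open>l\<close> are an orbit of the unipotent group fixing \<open>l\<close>.
  The parameter \<open>t\<close> is the middle coefficient of the form in a basis that starts with \<open>l\<close>; in this parameter
  the discriminant of the difference to \<open>p\<close> is a quadratic polynomial with a completed square.\<close>

lemma fibre_parametrization:
  assumes l: "l \<in> proj_line" and \<gamma>: "\<gamma> \<noteq> 0"
  obtains \<phi> where "bij_betw \<phi> UNIV {r \<in> quadric. binary_form r l = \<gamma>}"
    "\<And>p. p \<in> quadric \<Longrightarrow> \<exists>c. \<forall>t. \<gamma> * binary_form p l * disc (\<phi> t - p) = (binary_form p l * t - c)\<^sup>2 - n * (\<gamma> - binary_form p l)\<^sup>2"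
proof -
  consider "l = (1, 0)" | s where "l = (s, 1)" using l by (auto simp: proj_line_def)
  then show thesis
  proof cases
    case 1
    define a where "a t = (t\<^sup>2 - n) / \<gamma>" for t
    have a: "\<gamma> * a t = t\<^sup>2 - n" for t using \<gamma> by (simp add: a_def)
    define \<phi> :: "'a \<Rightarrow> 'a ^ 3" where "\<phi> t = vector [\<gamma>, t, a t]" for t
    have "bij_betw \<phi> UNIV {r \<in> quadric. binary_form r l = \<gamma>}"
    proof (rule bij_betw_byWitness[where f' = "\<lambda>r. r $ 2"])
      show "\<forall>r\<in>{r \<in> quadric. binary_form r l = \<gamma>}. \<phi> (r $ 2) = r"
        using \<gamma> by (auto simp: 1 binary_form.simps quadric_def disc_def \<phi>_def a_def vec_eq_iff forall_3)
      show "range \<phi> \<subseteq> {r \<in> quadric. binary_form r l = \<gamma>}"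
        by (auto simp: \<phi>_def 1 binary_form.simps quadric_def disc_def a)
    qed (simp_all add: \<phi>_def)
    moreover have "\<exists>c. \<forall>t. \<gamma> * binary_form p l * disc (\<phi> t - p) = (binary_form p l * t - c)\<^sup>2 - n * (\<gamma> - binary_form p l)\<^sup>2"
      if p: "p \<in> quadric" for p
    proof (intro exI allI)
      fix t
      define k where "k = binary_form p l"
      have p1: "p $ 1 = k" by (simp add: k_def 1 binary_form.simps)
      have pn: "k * p $ 3 = (p $ 2)\<^sup>2 - n" using p by (auto simp: quadric_def disc_def p1[symmetric])
      have eq: "disc (\<phi> t - p) = (t - p $ 2)\<^sup>2 - (a t - p $ 3) * (\<gamma> - k)"
        by (simp add: \<phi>_def disc_def p1)
      have "\<gamma> * k * disc (\<phi> t - p) = \<gamma> * k * (t - p $ 2)\<^sup>2 - (k * (\<gamma> * a t) - \<gamma> * (k * p $ 3)) * (\<gamma> - k)"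
        unfolding eq by (simp add: algebra_simps)
      also have "\<dots> = (k * t - \<gamma> * p $ 2)\<^sup>2 - n * (\<gamma> - k)\<^sup>2"
        unfolding a pn by (simp add: power2_eq_square algebra_simps)
      finally show "\<gamma> * binary_form p l * disc (\<phi> t - p) = (binary_form p l * t - \<gamma> * p $ 2)\<^sup>2 - n * (\<gamma> - binary_form p l)\<^sup>2"
        by (simp add: k_def)
    qed
    ultimately show thesis by (rule that)
  next
    case (2 s)
    define a where "a t = (t\<^sup>2 - n) / \<gamma>" for t
    have a: "\<gamma> * a t = t\<^sup>2 - n" for t using \<gamma> by (simp add: a_def)
    define \<phi> :: "'a \<Rightarrow> 'a ^ 3" where "\<phi> t = vector [a t, t - a t * s, \<gamma> + a t * s\<^sup>2 - 2 * t * s]" for t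
    have "bij_betw \<phi> UNIV {r \<in> quadric. binary_form r l = \<gamma>}"
    proof (rule bij_betw_byWitness[where f' = "\<lambda>r. r $ 2 + r $ 1 * s"])
      show "\<forall>r\<in>{r \<in> quadric. binary_form r l = \<gamma>}. \<phi> (r $ 2 + r $ 1 * s) = r"
      proof
        fix r assume r: "r \<in> {r \<in> quadric. binary_form r l = \<gamma>}"
        then have g: "\<gamma> = r $ 1 * s\<^sup>2 + 2 * r $ 2 * s + r $ 3" and d: "n = (r $ 2)\<^sup>2 - r $ 1 * r $ 3"
          by (simp_all add: 2 binary_form.simps quadric_def disc_def)
        have "\<gamma> * a (r $ 2 + r $ 1 * s) = \<gamma> * r $ 1"
          unfolding a unfolding g d by (simp add: power2_eq_square algebra_simps)
        then have "a (r $ 2 + r $ 1 * s) = r $ 1" using \<gamma> by simp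
        then show "\<phi> (r $ 2 + r $ 1 * s) = r"
          by (simp add: \<phi>_def vec_eq_iff forall_3 g power2_eq_square algebra_simps)
      qed
      show "range \<phi> \<subseteq> {r \<in> quadric. binary_form r l = \<gamma>}"
      proof clarify
        fix t
        have "disc (\<phi> t) = t\<^sup>2 - \<gamma> * a t"
          by (simp add: \<phi>_def disc_def power2_eq_square algebra_simps)
        moreover have "binary_form (\<phi> t) l = \<gamma>"
          by (simp add: \<phi>_def 2 binary_form.simps power2_eq_square algebra_simps)
        ultimately show "\<phi> t \<in> quadric \<and> binary_form (\<phi> t) l = \<gamma>" by (simp add: quadric_def a)
      qed
    qed (simp_all add: \<phi>_def)
    moreover have "\<exists>c. \<forall>t. \<gamma> * binary_form p l * disc (\<phi> t - p) = (binary_form p l * t - c)\<^sup>2 - n * (\<gamma> - binary_form p l)\<^sup>2"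
      if p: "p \<in> quadric" for p
    proof (intro exI allI)
      fix t
      define m k where "m = p $ 2 + p $ 1 * s" and "k = binary_form p l"
      have p2: "p $ 2 = m - p $ 1 * s" by (simp add: m_def)
      have p3: "p $ 3 = k + p $ 1 * s\<^sup>2 - 2 * m * s"
        by (simp add: m_def k_def 2 binary_form.simps power2_eq_square algebra_simps)
      have pn: "k * p $ 1 = m\<^sup>2 - n"
        using p by (simp add: quadric_def disc_def m_def k_def 2 binary_form.simps power2_eq_square algebra_simps)
      have eq: "disc (\<phi> t - p) = (t - m)\<^sup>2 - (a t - p $ 1) * (\<gamma> - k)"
        by (simp add: \<phi>_def disc_def p2 p3 power2_eq_square algebra_simps)
      have "\<gamma> * k * disc (\<phi> t - p) = \<gamma> * k * (t - m)\<^sup>2 - (k * (\<gamma> * a t) - \<gamma> * (k * p $ 1)) * (\<gamma> - k)"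
        unfolding eq by (simp add: algebra_simps)
      also have "\<dots> = (k * t - \<gamma> * m)\<^sup>2 - n * (\<gamma> - k)\<^sup>2"
        unfolding a pn by (simp add: power2_eq_square algebra_simps)
      finally show "\<gamma> * binary_form p l * disc (\<phi> t - p) = (binary_form p l * t - \<gamma> * (p $ 2 + p $ 1 * s))\<^sup>2 - n * (\<gamma> - binary_form p l)\<^sup>2"
        by (simp add: k_def m_def)
    qed
    ultimately show thesis by (rule that)
  qed
qed

lemma card_fibre: "l \<in> proj_line \<Longrightarrow> \<gamma> \<noteq> 0 \<Longrightarrow> card {r \<in> quadric. binary_form r l = \<gamma>} = CARD('a)"
  by (erule (1) fibre_parametrization) (auto dest: bij_betw_same_card)

text \<open>Let \<open>k\<close> be the value of the form of \<open>p\<close> at \<open>l\<close>. By the parametrization, the character values on a fibre add up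
  to the sign of \<open>\<gamma> k\<close> times the character sum of \<open>t\<^sup>2 - n (\<gamma> - k)\<^sup>2\<close>, which jumps by \<open>q\<close> when \<open>\<gamma> = k\<close>. In that
  case the diagonal term of the kernel adds another \<open>q\<close>.\<close>

lemma sum_agreement_fibre:
  assumes l: "l \<in> proj_line" and \<gamma>: "\<gamma> \<noteq> 0" and p: "p \<in> quadric"
  shows "(\<Sum>r | r \<in> quadric \<and> binary_form r l = \<gamma>. agreement r p) =
    (if \<gamma> = binary_form p l then 2 * q else 0) - quad_char (\<gamma> * binary_form p l)"
proof -
  define k where "k = binary_form p l"
  have k: "k \<noteq> 0" using binary_form_proj_line_neq_0[OF p l] by (simp add: k_def)
  obtain \<phi> where \<phi>: "bij_betw \<phi> UNIV {r \<in> quadric. binary_form r l = \<gamma>}"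
    and d: "\<And>p. p \<in> quadric \<Longrightarrow> \<exists>c. \<forall>t. \<gamma> * binary_form p l * disc (\<phi> t - p) = (binary_form p l * t - c)\<^sup>2 - n * (\<gamma> - binary_form p l)\<^sup>2"
    by (rule fibre_parametrization[OF l \<gamma>], blast)
  from d[OF p] obtain c where c: "\<And>t. \<gamma> * k * disc (\<phi> t - p) = (k * t - c)\<^sup>2 - n * (\<gamma> - k)\<^sup>2"
    unfolding k_def by blast
  have "quad_char (disc (\<phi> t - p)) = quad_char (\<gamma> * k) * quad_char ((k * t - c)\<^sup>2 - n * (\<gamma> - k)\<^sup>2)" for t
    unfolding c[symmetric] using k \<gamma>
    by (simp only: quad_char_mult[of "\<gamma> * k"] mult.assoc[symmetric])
      (simp add: quad_char_mult_self)
  then have "(\<Sum>r | r \<in> quadric \<and> binary_form r l = \<gamma>. quad_char (disc (r - p))) =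
      quad_char (\<gamma> * k) * (\<Sum>t\<in>UNIV. quad_char ((k * t - c)\<^sup>2 - n * (\<gamma> - k)\<^sup>2))"
    by (simp add: sum.reindex_bij_betw[OF \<phi>, symmetric] sum_distrib_left)
  also have "(\<Sum>t\<in>UNIV. quad_char ((k * t - c)\<^sup>2 - n * (\<gamma> - k)\<^sup>2)) = (\<Sum>t\<in>UNIV. quad_char (t\<^sup>2 - n * (\<gamma> - k)\<^sup>2))"
    by (rule sum.reindex_bij_witness[of _ "\<lambda>t. (t + c) / k" "\<lambda>t. k * t - c"]) (use k in auto)
  also have "quad_char (\<gamma> * k) * \<dots> = (if \<gamma> = k then q else 0) - quad_char (\<gamma> * k)"
    using k n_neq_0 by (auto simp: sum_quad_char_square_minus quad_char_mult quad_char_mult_self)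
  finally have 1: "(\<Sum>r | r \<in> quadric \<and> binary_form r l = \<gamma>. quad_char (disc (r - p))) =
      (if \<gamma> = k then q else 0) - quad_char (\<gamma> * k)" .
  have 2: "(\<Sum>r | r \<in> quadric \<and> binary_form r l = \<gamma>. if r = p then q else 0) = (if \<gamma> = k then q else 0)"
    using p by (auto simp: k_def)
  show ?thesis using 1 2 by (simp add: agreement_def sum.distrib k_def)
qed

lemma sum_by_fibres:
  fixes f :: "'a ^ 3 \<Rightarrow> int"
  assumes "l \<in> proj_line"
  shows "(\<Sum>r\<in>quadric. f r) = (\<Sum>\<gamma>\<in>UNIV - {0}. \<Sum>r | r \<in> quadric \<and> binary_form r l = \<gamma>. f r)"
  by (subst sum.group[symmetric, where T = "UNIV - {0}" and g = "\<lambda>r. binary_form r l"])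
    (auto simp: binary_form_proj_line_neq_0[OF _ assms])

lemma sum_quad_char_nonzero: "(\<Sum>x\<in>UNIV - {0}. quad_char (x :: 'a)) = 0"
  using sum_quad_char by (simp add: sum_diff1)

lemma sum_agreement:
  assumes "p \<in> quadric"
  shows "(\<Sum>r\<in>quadric. agreement r p) = 2 * q"
proof -
  have l: "(1, 0) \<in> proj_line" by (simp add: proj_line_def)
  have "binary_form p (1, 0) \<noteq> 0" by (rule binary_form_proj_line_neq_0[OF assms l])
  then show ?thesis
    by (simp add: sum_by_fibres[OF l] sum_agreement_fibre[OF l _ assms] sum_subtractf quad_char_mult
        sum_quad_char_nonzero flip: sum_distrib_right)
qed

text \<open>Expand the first factor as a sum over the projective line; each point contributes a sum of the second
  factor over one fibre.\<close>

lemma agreement_square: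
  assumes p: "p \<in> quadric" and p': "p' \<in> quadric"
  shows "(\<Sum>r\<in>quadric. agreement p r * agreement r p') = 2 * q * agreement p p' - sign_correlation p p'"
proof -
  have "(\<Sum>r\<in>quadric. agreement p r * agreement r p') =
      (\<Sum>r\<in>quadric. (\<Sum>l\<in>proj_line. (if binary_form r l = binary_form p l then agreement r p' else 0)) - agreement r p')"
    by (rule sum.cong[OF refl])
      (auto simp: agreement_eq_sum[of p] algebra_simps sum_distrib_left eq_commute[of "binary_form p _"] intro!: sum.cong)
  also have "\<dots> = (\<Sum>l\<in>proj_line. \<Sum>r | r \<in> quadric \<and> binary_form r l = binary_form p l. agreement r p') - 2 * q"
    by (simp add: sum_subtractf sum_agreement[OF p'] sum.swap[of _ proj_line] sum.inter_filter)
  also have "\<dots> = (\<Sum>l\<in>proj_line. (if binary_form p l = binary_form p' l then 2 * q else 0) - quad_char (binary_form p l * binary_form p' l)) - 2 * q"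
    by (simp add: sum_agreement_fibre p' binary_form_proj_line_neq_0[OF p])
  also have "(\<Sum>l\<in>proj_line. (if binary_form p l = binary_form p' l then 2 * q else 0) - quad_char (binary_form p l * binary_form p' l)) =
      2 * q * (\<Sum>l\<in>proj_line. if binary_form p l = binary_form p' l then 1 else 0) - sign_correlation p p'"
    by (simp add: sign_correlation_def sum_subtractf sum_distrib_left if_distrib[where f = "\<lambda>x. 2 * q * x"] cong: if_cong)
  finally show ?thesis by (simp add: agreement_eq_sum algebra_simps)
qed

text \<open>The functions \<open>r \<mapsto> quad_char (binary_form r l)\<close>, of which the sign correlation is composed, are eigenvectors
  of the agreement kernel: sum over the fibres of the value at \<open>l\<close>.\<close>

lemma sign_correlation_agreement:
  assumes p: "p \<in> quadric" and p': "p' \<in> quadric"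
  shows "(\<Sum>r\<in>quadric. sign_correlation p r * agreement r p') = (q + 1) * sign_correlation p p'"
proof -
  have eig: "(\<Sum>r\<in>quadric. quad_char (binary_form r l) * agreement r p') = (q + 1) * quad_char (binary_form p' l)" if l: "l \<in> proj_line" for l
  proof -
    define k where "k = binary_form p' l"
    have k: "k \<noteq> 0" using binary_form_proj_line_neq_0[OF p' l] by (simp add: k_def)
    have "(\<Sum>r\<in>quadric. quad_char (binary_form r l) * agreement r p') =
        (\<Sum>\<gamma>\<in>UNIV - {0}. quad_char \<gamma> * (\<Sum>r | r \<in> quadric \<and> binary_form r l = \<gamma>. agreement r p'))"
      unfolding sum_by_fibres[OF l] sum_distrib_left by (intro sum.cong) auto
    also have "\<dots> = (\<Sum>\<gamma>\<in>UNIV - {0}. (if \<gamma> = k then 2 * q * quad_char k else 0) - quad_char k)"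
    proof (rule sum.cong[OF refl])
      fix \<gamma> :: 'a assume g: "\<gamma> \<in> UNIV - {0}"
      then have "quad_char \<gamma> * quad_char (\<gamma> * k) = quad_char k"
        by (cases \<gamma> rule: quad_char_cases) (auto simp: quad_char_mult)
      then show "quad_char \<gamma> * (\<Sum>r | r \<in> quadric \<and> binary_form r l = \<gamma>. agreement r p') =
          (if \<gamma> = k then 2 * q * quad_char k else 0) - quad_char k"
        using g by (auto simp: sum_agreement_fibre[OF l _ p'] right_diff_distrib simp flip: k_def)
    qed
    also have "\<dots> = 2 * q * quad_char k - (q - 1) * quad_char k"
      using k by (simp add: sum_subtractf card_Diff_singleton of_nat_diff)
    finally show ?thesis by (simp add: k_def algebra_simps)
  qed
  have "(\<Sum>r\<in>quadric. sign_correlation p r * agreement r p') =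
      (\<Sum>l\<in>proj_line. quad_char (binary_form p l) * (\<Sum>r\<in>quadric. quad_char (binary_form r l) * agreement r p'))"
    by (simp add: sign_correlation_def quad_char_mult sum_distrib_left sum_distrib_right mult.assoc) (rule sum.swap)
  also have "\<dots> = (\<Sum>l\<in>proj_line. quad_char (binary_form p l) * ((q + 1) * quad_char (binary_form p' l)))"
    by (rule sum.cong) (simp_all only: eig)
  also have "\<dots> = (q + 1) * sign_correlation p p'"
    by (simp add: sign_correlation_def quad_char_mult sum_distrib_left mult_ac)
  finally show ?thesis .
qed

lemma card_quadric: "int (card quadric) = q * (q - 1)"
proof -
  have l: "(1, 0) \<in> (proj_line :: ('a \<times> 'a) set)" by (simp add: proj_line_def)
  have "int (card quadric) = (\<Sum>\<gamma>\<in>(UNIV :: 'a set) - {0}. q)"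
    using sum_by_fibres[OF l, of "\<lambda>_. 1"] card_fibre[OF l] by simp
  then show ?thesis by (simp add: card_Diff_singleton of_nat_diff)
qed

end

section \<open>Counting conjugate points\<close>

lemma sum_If_1_0: "finite A \<Longrightarrow> (\<Sum>x\<in>A. if P x then 1 else 0 :: int) = int (card {x \<in> A. P x})"
  by (simp add: sum.If_cases Int_def)

text \<open>The pole of the line through \<open>p\<close> and \<open>r\<close>: the cross product of the coordinate vectors of their polar lines.\<close>

definition polar_pole :: "'a::field ^ 3 \<Rightarrow> 'a ^ 3 \<Rightarrow> 'a ^ 3" where
  "polar_pole p r = vector [2 * (p $ 1 * r $ 2 - p $ 2 * r $ 1), p $ 1 * r $ 3 - p $ 3 * r $ 1,
     2 * (p $ 2 * r $ 3 - p $ 3 * r $ 2)]"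

lemma polar_polar_pole [simp]: "polar (polar_pole p r) p = 0" "polar (polar_pole p r) r = 0"
  by (simp_all add: polar_pole_def polar_def algebra_simps)

lemma disc_polar_pole: "disc (polar_pole p r) = (polar p r)\<^sup>2 - 4 * disc p * disc r"
  by (simp add: polar_pole_def polar_def disc_def power2_eq_square algebra_simps)

lemma orthogonal_imp_multiple_polar_pole:
  fixes p r t :: "'a::field ^ 3"
  assumes "polar t p = 0" "polar t r = 0" "polar_pole p r \<noteq> 0"
  obtains c where "t = c *s polar_pole p r"
proof -
  define S where "S = polar_pole p r"
  have S: "S $ 1 = 2 * (p $ 1 * r $ 2 - p $ 2 * r $ 1)" "S $ 2 = p $ 1 * r $ 3 - p $ 3 * r $ 1"
     "S $ 3 = 2 * (p $ 2 * r $ 3 - p $ 3 * r $ 2)"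
    by (simp_all add: S_def polar_pole_def)
  have "t $ 2 * S $ 1 - t $ 1 * S $ 2 = p $ 1 * polar t r - r $ 1 * polar t p"
    by (simp add: S polar_def algebra_simps)
  then have 1: "t $ 2 * S $ 1 = t $ 1 * S $ 2" using assms by simp
  have "t $ 2 * S $ 3 - t $ 3 * S $ 2 = r $ 3 * polar t p - p $ 3 * polar t r"
    by (simp add: S polar_def algebra_simps)
  then have 2: "t $ 2 * S $ 3 = t $ 3 * S $ 2" using assms by simp
  have "t $ 1 * S $ 3 - t $ 3 * S $ 1 = 2 * (r $ 2 * polar t p - p $ 2 * polar t r)"
    by (simp add: S polar_def algebra_simps)
  then have 3: "t $ 1 * S $ 3 = t $ 3 * S $ 1" using assms by simp
  have "\<exists>i. S $ i \<noteq> 0" using assms(3) by (auto simp: S_def vec_eq_iff)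
  then consider "S $ 1 \<noteq> 0" | "S $ 2 \<noteq> 0" | "S $ 3 \<noteq> 0" by (auto simp: forall_3 simp flip: not_all)
  then have "\<exists>c. t = c *s S"
  proof cases
    case a: 1
    show ?thesis by (rule exI[of _ "t $ 1 / S $ 1"])
      (use a 1 2 3 in \<open>simp add: vec_eq_iff forall_3 field_simps\<close>)
  next
    case a: 2
    show ?thesis by (rule exI[of _ "t $ 2 / S $ 2"])
      (use a 1 2 3 in \<open>simp add: vec_eq_iff forall_3 field_simps\<close>)
  next
    case a: 3
    show ?thesis by (rule exI[of _ "t $ 3 / S $ 3"])
      (use a 1 2 3 in \<open>simp add: vec_eq_iff forall_3 field_simps\<close>)
  qed
  then show thesis using that by (auto simp: S_def)
qed

context nonsplit_quadric
begin

definition perp :: "'a ^ 3 \<Rightarrow> 'a ^ 3 \<Rightarrow> int" where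
  "perp p r = (if polar p r = 0 then 1 else 0)"

text \<open>The argument of the character is the discriminant of the pole of the line through \<open>p\<close> and \<open>r\<close>, so for
  distinct points the condition says that this line is a passant. It fails for \<open>r = p\<close> and \<open>r = - p\<close>, where the
  argument is zero.\<close>

definition passant_joined :: "'a ^ 3 \<Rightarrow> 'a ^ 3 \<Rightarrow> int" where
  "passant_joined p r = (if quad_char ((polar p r)\<^sup>2 - 4 * n\<^sup>2) = - 1 then 1 else 0)"

lemma quad_char_minus: "quad_char (- x :: 'a) = quad_char (- 1 :: 'a) * quad_char x"
  using quad_char_mult[of "- 1" x] by simp

lemma quad_char_4: "quad_char (4 :: 'a) = 1"
  using quad_char_square[of "2 :: 'a"] two_neq_0 by simp

lemma polar_square_neq:
  assumes "p \<in> quadric" "r \<in> quadric" "p \<noteq> r" "p \<noteq> - r"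
  shows "(polar p r)\<^sup>2 - 4 * n\<^sup>2 \<noteq> 0"
proof -
  have "disc (p - r) * disc (p + r) = - ((polar p r)\<^sup>2 - 4 * n\<^sup>2)"
    using assms by (simp add: disc_diff disc_add quadric_def power2_eq_square algebra_simps)
  moreover have "disc (p - r) \<noteq> 0" using disc_diff_eq_0 assms by blast
  moreover have "disc (p + r) \<noteq> 0"
    using disc_diff_eq_0[of p "- r"] assms uminus_quadric by auto
  ultimately show ?thesis by auto
qed

text \<open>Eliminating one coordinate by the linear condition leaves \<open>t\<^sup>2 - n x\<^sup>2 = n (p $ 1)\<^sup>2\<close>, an anisotropic binary norm
  equation.\<close>

lemma card_perp:
  assumes p: "p \<in> quadric"
  shows "int (card {s \<in> quadric. polar p s = 0}) = q + 1"
proof -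
  have p1: "p $ 1 \<noteq> 0" using binary_form_neq_0[OF p, of 1 0] by (simp add: binary_form.simps)
  have pn: "p $ 1 * p $ 3 = (p $ 2)\<^sup>2 - n" using p by (auto simp: quadric_def disc_def)
  define X where "X = {(t, x). x \<in> (UNIV :: 'a set) \<and> t\<^sup>2 = n * x\<^sup>2 + n * (p $ 1)\<^sup>2}"
  define \<phi> :: "'a \<times> 'a \<Rightarrow> 'a ^ 3" where
    "\<phi> = (\<lambda>(t, x). vector [x, (t + p $ 2 * x) / p $ 1, (2 * p $ 2 * ((t + p $ 2 * x) / p $ 1) - x * p $ 3) / p $ 1])"
  have key: "(p $ 1 * s $ 2 - p $ 2 * s $ 1)\<^sup>2 = n * (s $ 1)\<^sup>2 + (p $ 1)\<^sup>2 * disc s - p $ 1 * s $ 1 * polar p s" for s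
  proof -
    have "(p $ 1 * s $ 2 - p $ 2 * s $ 1)\<^sup>2 = ((p $ 2)\<^sup>2 - p $ 1 * p $ 3) * (s $ 1)\<^sup>2 + (p $ 1)\<^sup>2 * disc s - p $ 1 * s $ 1 * polar p s"
      by (simp add: polar_def disc_def power2_eq_square algebra_simps)
    then show ?thesis by (simp add: pn)
  qed
  have perp: "polar p (\<phi> (t, x)) = 0" for t x
    using p1 by (simp add: \<phi>_def polar_def)
  have inv: "p $ 1 * \<phi> (t, x) $ 2 - p $ 2 * x = t" "\<phi> (t, x) $ 1 = x" for t x
    using p1 by (simp_all add: \<phi>_def)
  have "bij_betw \<phi> X {s \<in> quadric. polar p s = 0}"
  proof (rule bij_betw_byWitness[where f' = "\<lambda>s. (p $ 1 * s $ 2 - p $ 2 * s $ 1, s $ 1)"])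
    show "\<forall>a\<in>X. (p $ 1 * \<phi> a $ 2 - p $ 2 * \<phi> a $ 1, \<phi> a $ 1) = a"
      using inv by auto
    show "\<forall>s\<in>{s \<in> quadric. polar p s = 0}. \<phi> (p $ 1 * s $ 2 - p $ 2 * s $ 1, s $ 1) = s"
      using p1 by (auto simp: \<phi>_def vec_eq_iff forall_3 polar_def field_simps)
    show "\<phi> ` X \<subseteq> {s \<in> quadric. polar p s = 0}"
    proof clarify
      fix t x assume "(t, x) \<in> X"
      then have "n * (p $ 1)\<^sup>2 = (p $ 1)\<^sup>2 * disc (\<phi> (t, x))"
        using key[of "\<phi> (t, x)"] by (simp add: inv perp X_def)
      then have "disc (\<phi> (t, x)) = n" using p1 by simp
      then show "\<phi> (t, x) \<in> quadric \<and> polar p (\<phi> (t, x)) = 0"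
        by (simp add: perp quadric_def)
    qed
    show "(\<lambda>s. (p $ 1 * s $ 2 - p $ 2 * s $ 1, s $ 1)) ` {s \<in> quadric. polar p s = 0} \<subseteq> X"
      by (auto simp: X_def key quadric_def)
  qed
  then have "int (card {s \<in> quadric. polar p s = 0}) = int (card X)"
    by (simp add: bij_betw_same_card)
  also have "\<dots> = (\<Sum>x\<in>UNIV. 1 + quad_char (n * (x\<^sup>2 - - (p $ 1)\<^sup>2)))"
    using sum_square_roots[of UNIV "\<lambda>x. n * x\<^sup>2 + n * (p $ 1)\<^sup>2"]
    unfolding X_def by (simp add: distrib_left)
  also have "\<dots> = q - (\<Sum>x\<in>UNIV. quad_char (x\<^sup>2 - - (p $ 1)\<^sup>2))"
    unfolding quad_char_mult n_nonsquare by (simp add: sum_subtractf)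
  also have "\<dots> = q + 1"
    using p1 by (subst sum_quad_char_square_minus) simp
  finally show ?thesis .
qed

text \<open>Only the two normalizations of the pole of the line through \<open>p\<close> and \<open>r\<close> can be counted, and they exist exactly
  when the pole is internal.\<close>

lemma card_perp2:
  assumes p: "p \<in> quadric" and r: "r \<in> quadric" and neq: "p \<noteq> r" "p \<noteq> - r"
  shows "int (card {s \<in> quadric. polar p s = 0 \<and> polar s r = 0}) = 2 * passant_joined p r"
proof -
  define S where "S = polar_pole p r"
  have dS: "disc S = (polar p r)\<^sup>2 - 4 * n\<^sup>2"
    using p r by (simp add: S_def disc_polar_pole quadric_def power2_eq_square)
  then have dS0: "disc S \<noteq> 0" using polar_square_neq[OF p r neq] by simp
  then have S0: "S \<noteq> 0" by auto
  have "bij_betw (\<lambda>c. c *s S) {c. c\<^sup>2 = n / disc S} {s \<in> quadric. polar p s = 0 \<and> polar s r = 0}"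
  proof (rule bij_betw_imageI)
    show "inj_on (\<lambda>c. c *s S) {c. c\<^sup>2 = n / disc S}"
      using S0 by (auto intro!: inj_onI)
    show "(\<lambda>c. c *s S) ` {c. c\<^sup>2 = n / disc S} = {s \<in> quadric. polar p s = 0 \<and> polar s r = 0}"
    proof safe
      fix c assume c: "c\<^sup>2 = n / disc S"
      show "c *s S \<in> quadric" using c dS0 by (simp add: quadric_def disc_scale)
      show "polar p (c *s S) = 0" "polar (c *s S) r = 0"
        by (simp_all add: polar_commute[of p] polar_scale_left S_def)
    next
      fix s assume s: "s \<in> quadric" "polar p s = 0" "polar s r = 0"
      then obtain c where c: "s = c *s S"
        using orthogonal_imp_multiple_polar_pole[of s p r] S0 by (auto simp: S_def polar_commute)
      then have "c\<^sup>2 = n / disc S" using s(1) dS0 by (simp add: quadric_def disc_scale field_simps)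
      then show "s \<in> (\<lambda>c. c *s S) ` {c. c\<^sup>2 = n / disc S}" using c by blast
    qed
  qed
  then have "int (card {s \<in> quadric. polar p s = 0 \<and> polar s r = 0}) = 1 - quad_char (disc S)"
    using card_square_roots[of "n / disc S"] by (simp add: bij_betw_same_card quad_char_divide n_nonsquare)
  then show ?thesis
    using dS0 by (cases "disc S" rule: quad_char_cases) (auto simp: passant_joined_def dS)
qed

text \<open>In the plane conjugate to \<open>p\<close> take orthogonal coordinates \<open>(i, j)\<close>: the projection of \<open>p'\<close> and the pole of the line
  joining \<open>p\<close> and \<open>p'\<close>. Both conditions depend only on the squares of the coordinates, so solutions off the axes come in
  quadruples. Modulo \<open>4\<close> only the solutions on the two axes remain. They occur only if \<open>-1\<close> is a non-square; there are
  then four of them or none unless \<open>p\<close> and \<open>p'\<close> are conjugate, and two of them if they are: for conjugate points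
  the projection of \<open>p'\<close> is \<open>p'\<close> itself, which is not joined to \<open>p'\<close>.\<close>

lemma card_perp_passant_joined:
  assumes p: "p \<in> quadric" and p': "p' \<in> quadric" and neq: "p \<noteq> p'" "p \<noteq> - p'"
  shows "[int (card {s \<in> quadric. polar p s = 0 \<and> passant_joined s p' = 1}) =
    (if quad_char (- 1 :: 'a) = - 1 then 2 * perp p p' else 0)] (mod 4)"
proof -
  define S where "S = polar_pole p p'"
  define b where "b = polar p p'"
  define \<Delta> where "\<Delta> = 4 * n\<^sup>2 - b\<^sup>2"
  define \<epsilon> where "\<epsilon> = quad_char (- 1 :: 'a)"
  have \<epsilon>: "\<epsilon> = 1 \<or> \<epsilon> = - 1" by (simp add: \<epsilon>_def quad_char_minus_1)
  have \<Delta>0: "\<Delta> \<noteq> 0" using polar_square_neq[OF p p' neq] by (simp add: \<Delta>_def b_def)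
  have dS: "disc S = - \<Delta>"
    using p p' by (simp add: S_def \<Delta>_def b_def disc_polar_pole quadric_def power2_eq_square)
  then have S0: "S \<noteq> 0" using \<Delta>0 by auto
  define \<pi> where "\<pi> = (2 * n) *s p' - b *s p"
  have \<pi>p: "polar \<pi> p = 0"
    using p by (simp add: \<pi>_def polar_diff_left polar_scale_left polar_self quadric_def b_def polar_commute[of p' p])
  have \<pi>p': "polar \<pi> p' = \<Delta>"
    using p' by (simp add: \<pi>_def \<Delta>_def polar_diff_left polar_scale_left polar_self quadric_def b_def power2_eq_square)
  have d\<pi>: "disc \<pi> = n * \<Delta>"
  proof -
    have "2 * disc \<pi> = polar \<pi> \<pi>" by (simp add: polar_self)
    also have "\<dots> = 2 * n * polar p' \<pi> - b * polar p \<pi>"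
      by (subst (1) \<pi>_def) (simp add: polar_diff_left polar_scale_left)
    also have "\<dots> = 2 * (n * \<Delta>)" using \<pi>p \<pi>p' by (simp add: polar_commute)
    finally show ?thesis using two_neq_0 by simp
  qed
  have \<pi>S: "polar \<pi> S = 0"
    by (simp add: \<pi>_def polar_diff_left polar_scale_left S_def polar_commute[of p "polar_pole p p'"]
        polar_commute[of p' "polar_pole p p'"])
  have disc_comb: "disc (i *s \<pi> + j *s S) = \<Delta> * (n * i\<^sup>2 - j\<^sup>2)" for i j
    by (simp add: disc_add disc_scale polar_scale_left polar_commute[of _ "j *s S"] polar_commute[of S] d\<pi> dS \<pi>S algebra_simps)
  have comb_p: "polar (i *s \<pi> + j *s S) p = 0" for i j
    by (simp add: polar_add_left polar_scale_left \<pi>p S_def)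
  have comb_p': "polar (i *s \<pi> + j *s S) p' = i * \<Delta>" for i j
    by (simp add: polar_add_left polar_scale_left \<pi>p' S_def)
  define I where "I = {i :: 'a. quad_char (i\<^sup>2 * \<Delta>\<^sup>2 - 4 * n\<^sup>2) = - 1}"
  define X where "X = {(j, i). i \<in> I \<and> j\<^sup>2 = n * (i\<^sup>2 - 1 / \<Delta>)}"
  have "bij_betw (\<lambda>(j, i). i *s \<pi> + j *s S) X {s \<in> quadric. polar p s = 0 \<and> passant_joined s p' = 1}"
  proof (rule bij_betw_imageI)
    show "inj_on (\<lambda>(j, i). i *s \<pi> + j *s S) X"
    proof (rule inj_onI, clarify)
      fix j i j' i' assume eq: "i *s \<pi> + j *s S = i' *s \<pi> + j' *s S"
      then have "i * \<Delta> = i' * \<Delta>" using comb_p' by metis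
      then have "i = i'" using \<Delta>0 by simp
      moreover from this have "j = j'" using eq S0 by simp
      ultimately show "j = j' \<and> i = i'" by simp
    qed
    show "(\<lambda>(j, i). i *s \<pi> + j *s S) ` X = {s \<in> quadric. polar p s = 0 \<and> passant_joined s p' = 1}"
    proof safe
      fix j i assume X: "(j, i) \<in> X"
      then have j2: "j\<^sup>2 = n * (i\<^sup>2 - 1 / \<Delta>)" by (simp add: X_def)
      show "i *s \<pi> + j *s S \<in> quadric"
        using \<Delta>0 by (simp add: quadric_def disc_comb j2 right_diff_distrib)
      show "polar p (i *s \<pi> + j *s S) = 0" using comb_p polar_commute by metis
      show "passant_joined (i *s \<pi> + j *s S) p' = 1"
        using X by (simp add: passant_joined_def comb_p' X_def I_def power_mult_distrib)
    next
      fix s assume s: "s \<in> quadric" "polar p s = 0" "passant_joined s p' = 1"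
      define i where "i = polar s p' / \<Delta>"
      have "polar (s - i *s \<pi>) p = 0" "polar (s - i *s \<pi>) p' = 0"
        using s \<Delta>0 by (simp_all add: polar_diff_left polar_scale_left \<pi>p \<pi>p' i_def polar_commute[of s])
      then obtain j where j: "s - i *s \<pi> = j *s S"
        using orthogonal_imp_multiple_polar_pole S0 unfolding S_def by blast
      then have s_eq: "s = i *s \<pi> + j *s S" by (simp add: algebra_simps)
      have "\<Delta> * (n * i\<^sup>2 - j\<^sup>2) = n" using s(1) unfolding s_eq by (simp add: disc_comb quadric_def)
      then have "j\<^sup>2 = n * (i\<^sup>2 - 1 / \<Delta>)" using \<Delta>0 by (auto simp: field_simps)
      moreover have "i \<in> I"
        using s(3) by (auto simp: s_eq passant_joined_def comb_p' I_def power_mult_distrib split: if_splits)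
      ultimately have "(j, i) \<in> X" by (simp add: X_def)
      then show "s \<in> (\<lambda>(j, i). i *s \<pi> + j *s S) ` X" using s_eq by auto
    qed
  qed
  then have cT: "int (card {s \<in> quadric. polar p s = 0 \<and> passant_joined s p' = 1}) =
      (\<Sum>i\<in>I. 1 + quad_char (n * (i\<^sup>2 - 1 / \<Delta>)))"
    unfolding X_def by (simp add: bij_betw_same_card[symmetric] sum_square_roots)
  \<comment> \<open>\<open>g i\<close> counts the admissible \<open>j\<close>; the solutions with \<open>j = 0\<close> are counted by \<open>e i\<close>, those with \<open>i = 0\<close> by \<open>g 0\<close>.\<close>
  define g where "g i = (if i \<in> I then 1 - quad_char (i\<^sup>2 - 1 / \<Delta>) else 0)" for i
  have cT: "int (card {s \<in> quadric. polar p s = 0 \<and> passant_joined s p' = 1}) = (\<Sum>i\<in>UNIV. g i)"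
    unfolding cT g_def by (simp add: sum.If_cases quad_char_mult n_nonsquare)
  define e :: "'a \<Rightarrow> int" where "e i = (if i\<^sup>2 = 1 / \<Delta> \<and> \<epsilon> = - 1 \<and> b \<noteq> 0 then 1 else 0)" for i
  have sum_e: "(\<Sum>i\<in>UNIV. e i) = (if \<epsilon> = - 1 \<and> b \<noteq> 0 then 1 + quad_char \<Delta> else 0)"
    using card_square_roots[of "1 / \<Delta>"] by (simp add: e_def sum.If_cases quad_char_divide)
  have even_ge: "even (g i - e i)" if "i \<noteq> 0" for i
  proof (cases "i\<^sup>2 = 1 / \<Delta>")
    case True
    have "i\<^sup>2 * \<Delta>\<^sup>2 = \<Delta>" using \<Delta>0 by (simp add: True power2_eq_square[of \<Delta>])
    then have "i\<^sup>2 * \<Delta>\<^sup>2 - 4 * n\<^sup>2 = - (b\<^sup>2)" by (simp add: \<Delta>_def)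
    then have "i \<in> I \<longleftrightarrow> \<epsilon> = - 1 \<and> b \<noteq> 0"
      by (cases "b = 0") (auto simp: I_def quad_char_minus[of "b\<^sup>2"] quad_char_square \<epsilon>_def)
    then show ?thesis using True by (simp add: g_def e_def)
  next
    case False
    then show ?thesis by (cases "i\<^sup>2 - 1 / \<Delta>" rule: quad_char_cases) (auto simp: g_def e_def)
  qed
  have "even (\<Sum>i\<in>UNIV - {0}. (g i - e i) div 2)"
    by (rule even_sum_involution[where f = uminus]) (use neg_neq in \<open>auto simp: g_def e_def I_def\<close>)
  then obtain z where z: "(\<Sum>i\<in>UNIV - {0}. (g i - e i) div 2) = 2 * z" by blast
  have "(\<Sum>i\<in>UNIV. g i) = g 0 - e 0 + (\<Sum>i\<in>UNIV - {0}. g i - e i) + (\<Sum>i\<in>UNIV. e i)"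
    by (simp add: sum.remove[of UNIV 0] sum_subtractf)
  also have "(\<Sum>i\<in>UNIV - {0}. g i - e i) = 2 * (\<Sum>i\<in>UNIV - {0}. (g i - e i) div 2)"
    unfolding sum_distrib_left by (rule sum.cong) (use even_ge in auto)
  also have "e 0 = 0" using \<Delta>0 by (simp add: e_def)
  also have "g 0 = (if \<epsilon> = - 1 then 1 + quad_char \<Delta> else 0)"
  proof -
    have "quad_char (- (4 * n\<^sup>2)) = \<epsilon>"
      using n_neq_0 by (simp add: quad_char_minus[of "4 * n\<^sup>2"] quad_char_mult quad_char_4 quad_char_square \<epsilon>_def)
    moreover have "quad_char (- (1 / \<Delta>)) = \<epsilon> * quad_char \<Delta>"
      by (simp add: quad_char_minus[of "1 / \<Delta>"] quad_char_divide \<epsilon>_def)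
    ultimately show ?thesis by (auto simp: g_def I_def)
  qed
  finally have sum_g: "(\<Sum>i\<in>UNIV. g i) = (if \<epsilon> = - 1 then 1 + quad_char \<Delta> else 0) + 4 * z +
      (if \<epsilon> = - 1 \<and> b \<noteq> 0 then 1 + quad_char \<Delta> else 0)"
    by (simp add: z sum_e)
  show ?thesis
  proof (cases "\<epsilon> = - 1")
    case True
    show ?thesis
    proof (cases "b = 0")
      case b: True
      have "quad_char \<Delta> = 1"
        using n_neq_0 by (simp add: \<Delta>_def b quad_char_mult quad_char_4 quad_char_square)
      then have "(\<Sum>i\<in>UNIV. g i) = 2 + 4 * z" using True b by (simp add: sum_g)
      then show ?thesis using True b by (simp add: cT perp_def b_def \<epsilon>_def cong_def)
    next
      case b: False
      have "quad_char \<Delta> = 1 \<or> quad_char \<Delta> = - 1" using \<Delta>0 by (cases \<Delta> rule: quad_char_cases) auto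
      then have "(\<Sum>i\<in>UNIV. g i) = 4 * (z + 1) \<or> (\<Sum>i\<in>UNIV. g i) = 4 * z" using True b by (auto simp: sum_g)
      then show ?thesis using True b by (auto simp: cT perp_def b_def cong_def simp del: mult_Suc_right)
    qed
  next
    case False
    then show ?thesis by (simp add: cT sum_g cong_def flip: \<epsilon>_def)
  qed
qed

end

section \<open>The conjugacy matrix modulo 2\<close>

text \<open>Internal points correspond to vectors of discriminant \<open>n\<close> up to sign; \<open>H\<close> chooses the signs.\<close>

locale half_quadric = nonsplit_quadric +
  fixes H :: "('a ^ 3) set"
  assumes quadric_eq: "quadric = H \<union> uminus ` H" and disjoint: "H \<inter> uminus ` H = {}"
begin

lemma in_quadric: "p \<in> H \<Longrightarrow> p \<in> quadric"
  using quadric_eq by blast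

lemma H_neq_minus: "p \<in> H \<Longrightarrow> r \<in> H \<Longrightarrow> p \<noteq> - r"
  using disjoint by blast

lemma sum_quadric: "(\<Sum>r\<in>quadric. g r) = (\<Sum>r\<in>H. g r + g (- r))" for g :: "'a ^ 3 \<Rightarrow> int"
  unfolding quadric_eq using disjoint
  by (subst sum.union_disjoint) (auto simp: sum.reindex sum.distrib)

lemma sum_quadric_even:
  fixes g :: "'a ^ 3 \<Rightarrow> int"
  assumes "\<And>r. g (- r) = g r"
  shows "(\<Sum>r\<in>quadric. g r) = 2 * (\<Sum>r\<in>H. g r)"
  by (simp add: sum_quadric assms sum_distrib_left)

lemma card_H: "2 * int (card H) = q * (q - 1)"
  using sum_quadric_even[of "\<lambda>_. 1"] card_quadric by simp

lemma perp_minus [simp]: "perp (- p) r = perp p r" "perp p (- r) = perp p r"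
  by (simp_all add: perp_def)

lemma passant_joined_minus [simp]: "passant_joined (- p) r = passant_joined p r" "passant_joined p (- r) = passant_joined p r"
  by (simp_all add: passant_joined_def)

lemma perp_commute: "perp p r = perp r p"
  by (simp add: perp_def polar_commute)

lemma perp_self: "p \<in> H \<Longrightarrow> perp p p = 0"
  using two_neq_0 n_neq_0 in_quadric[of p] by (simp add: perp_def polar_self quadric_def)

lemma passant_joined_self: "p \<in> H \<Longrightarrow> passant_joined p p = 0"
  using in_quadric[of p] by (simp add: passant_joined_def polar_self quadric_def power_mult_distrib)

text \<open>The number of internal points on a passant line.\<close>

definition passant_size :: int where "passant_size = (q + 1) div 2"

lemma odd_q: "odd q"
  using odd_card int_card by (metis even_of_nat_iff)

lemma two_passant_size: "2 * passant_size = q + 1"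
  unfolding passant_size_def using odd_q by presburger

lemma sum_perp:
  assumes "p \<in> H"
  shows "(\<Sum>r\<in>H. perp p r) = passant_size"
proof -
  have "2 * (\<Sum>r\<in>H. perp p r) = (\<Sum>r\<in>quadric. perp p r)"
    by (simp add: sum_quadric_even)
  also have "\<dots> = q + 1"
    using card_perp[OF in_quadric[OF assms]] by (simp add: perp_def sum_If_1_0)
  finally show ?thesis using two_passant_size by linarith
qed

lemma perp_square:
  assumes p: "p \<in> H" and r: "r \<in> H"
  shows "(\<Sum>s\<in>H. perp p s * perp s r) = (if p = r then passant_size else 0) + passant_joined p r"
proof (cases "p = r")
  case True
  have "(\<Sum>s\<in>H. perp p s * perp s p) = (\<Sum>s\<in>H. perp p s)"
    by (rule sum.cong) (auto simp: perp_def polar_commute)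
  then show ?thesis using True sum_perp[OF p] passant_joined_self[OF p] by simp
next
  case False
  have "2 * (\<Sum>s\<in>H. perp p s * perp s r) = (\<Sum>s\<in>quadric. perp p s * perp s r)"
    by (simp add: sum_quadric_even)
  also have "\<dots> = (\<Sum>s\<in>quadric. if polar p s = 0 \<and> polar s r = 0 then 1 else 0)"
    by (rule sum.cong) (auto simp: perp_def)
  also have "\<dots> = 2 * passant_joined p r"
    using card_perp2[OF in_quadric[OF p] in_quadric[OF r] False H_neq_minus[OF p r]]
    by (simp add: sum_If_1_0)
  finally show ?thesis using False by simp
qed

lemma even_passant_size_iff: "even passant_size \<longleftrightarrow> quad_char (- 1 :: 'a) = - 1"
proof -
  have "int (CARD('a) mod 4) = q mod 4" by (simp add: zmod_int)
  then have "quad_char (- 1 :: 'a) = - 1 \<longleftrightarrow> q mod 4 \<noteq> 1"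
    by (auto simp: quad_char_minus_1)
  then show ?thesis unfolding passant_size_def using odd_q by presburger
qed

lemma quad_char_minus_1_eq_1: "odd passant_size \<Longrightarrow> quad_char (- 1 :: 'a) = 1"
  using even_passant_size_iff by (cases "- 1 :: 'a" rule: quad_char_cases) auto

lemma perp_passant_joined:
  assumes p: "p \<in> H" and p': "p' \<in> H"
  shows "[(\<Sum>s\<in>H. perp p s * passant_joined s p') = perp p p' + passant_size * perp p p'] (mod 2)"
proof -
  have eq: "2 * (\<Sum>s\<in>H. perp p s * passant_joined s p') =
      int (card {s \<in> quadric. polar p s = 0 \<and> passant_joined s p' = 1})"
  proof -
    have "2 * (\<Sum>s\<in>H. perp p s * passant_joined s p') = (\<Sum>s\<in>quadric. perp p s * passant_joined s p')"
      by (simp add: sum_quadric_even)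
    also have "\<dots> = (\<Sum>s\<in>quadric. if polar p s = 0 \<and> passant_joined s p' = 1 then 1 else 0)"
      by (rule sum.cong) (auto simp: perp_def passant_joined_def)
    finally show ?thesis by (simp add: sum_If_1_0)
  qed
  show ?thesis
  proof (cases "p = p'")
    case True
    have "quad_char (- (4 * n\<^sup>2)) = quad_char (- 1 :: 'a)"
      using n_neq_0 by (simp add: quad_char_minus[of "4 * n\<^sup>2"] quad_char_mult quad_char_4 quad_char_square)
    then have "passant_joined s p = (if quad_char (- 1 :: 'a) = - 1 then 1 else 0)" if "polar p s = 0" for s
      using that by (simp add: passant_joined_def polar_commute[of s])
    then have "{s \<in> quadric. polar p s = 0 \<and> passant_joined s p' = 1} =
        (if even passant_size then {s \<in> quadric. polar p s = 0} else {})"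
      unfolding True[symmetric] even_passant_size_iff by auto
    then have "2 * (\<Sum>s\<in>H. perp p s * passant_joined s p') = (if even passant_size then 2 * passant_size else 0)"
      unfolding eq two_passant_size using card_perp[OF in_quadric[OF p]] by (cases "even passant_size") simp_all
    then have "even (\<Sum>s\<in>H. perp p s * passant_joined s p')" by (auto split: if_splits)
    then show ?thesis using perp_self[OF p] True by (simp add: cong_0_iff)
  next
    case False
    have halve: "[x = y] (mod 2)" if "[2 * x = 2 * y] (mod 4)" for x y :: int
      using that unfolding cong_iff_dvd_diff by presburger
    have "[2 * (\<Sum>s\<in>H. perp p s * passant_joined s p') = 2 * (if even passant_size then perp p p' else 0)] (mod 4)"
      using card_perp_passant_joined[OF in_quadric[OF p] in_quadric[OF p'] False H_neq_minus[OF p p']]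
      by (simp only: eq even_passant_size_iff if_distrib[of "(*) 2"] mult_zero_right)
    then have "[(\<Sum>s\<in>H. perp p s * passant_joined s p') = (if even passant_size then perp p p' else 0)] (mod 2)"
      by (rule halve)
    also have "[(if even passant_size then perp p p' else 0) = perp p p' + passant_size * perp p p'] (mod 2)"
      by (auto simp: cong_iff_dvd_diff)
    finally show ?thesis .
  qed
qed

text \<open>Writing \<open>A\<^sup>2 = \<rho> + C\<close> with \<open>\<rho> = (q + 1) / 2\<close>, the congruence \<open>A C = A + \<rho> A\<close> modulo \<open>2\<close> gives \<open>A\<^sup>3 = A + 2 \<rho> A\<close>.\<close>

lemma perp_cube:
  assumes p: "p \<in> H" and r: "r \<in> H"
  shows "[(\<Sum>k\<in>H. perp p k * (\<Sum>l\<in>H. perp k l * perp l r)) = perp p r] (mod 2)"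
proof -
  have "(\<Sum>k\<in>H. perp p k * (\<Sum>l\<in>H. perp k l * perp l r)) =
      (\<Sum>k\<in>H. (if k = r then passant_size * perp p k else 0) + perp p k * passant_joined k r)"
    by (rule sum.cong) (auto simp: perp_square[OF _ r] algebra_simps)
  also have "\<dots> = passant_size * perp p r + (\<Sum>k\<in>H. perp p k * passant_joined k r)"
    using r by (simp add: sum.distrib)
  also have "[\<dots> = passant_size * perp p r + (perp p r + passant_size * perp p r)] (mod 2)"
    by (intro cong_add cong_refl perp_passant_joined p r)
  also have "[passant_size * perp p r + (perp p r + passant_size * perp p r) = perp p r] (mod 2)"
    by (simp add: cong_iff_dvd_diff)
  finally show ?thesis .
qed

section \<open>Integral lifts of the idempotent\<close>

lemma agreement_commute: "agreement p r = agreement r p"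
proof -
  have "disc (p - r) = disc (r - p)" using disc_minus[of "p - r"] by simp
  then show ?thesis by (simp add: agreement_def)
qed

lemma agreement_minus_minus: "agreement (- p) r = agreement p (- r)"
proof -
  have "disc (- p - r) = disc (p + r)" using disc_minus[of "p + r"] by simp
  then show ?thesis by (auto simp: agreement_def)
qed

lemma sign_correlation_minus: "sign_correlation p (- r) = quad_char (- 1 :: 'a) * sign_correlation p r" "sign_correlation (- p) r = quad_char (- 1 :: 'a) * sign_correlation p r"
  by (simp_all add: sign_correlation_def quad_char_minus[of "binary_form p _ * binary_form r _"] sum_distrib_left)

lemma sign_correlation_self: "p \<in> quadric \<Longrightarrow> sign_correlation p p = q + 1"
  using binary_form_proj_line_neq_0[of p] by (simp add: sign_correlation_def quad_char_mult quad_char_mult_self)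
    (simp add: sum_proj_line[of "\<lambda>_. 1 :: int", simplified])

text \<open>The agreement kernel acts on even functions on the quadric, that is, on functions on internal points, by the sum
  over the two signs. This sum is always even; its half is the matrix \<open>F\<close> of the introduction.\<close>

definition half_agreement :: "'a ^ 3 \<Rightarrow> 'a ^ 3 \<Rightarrow> int" where
  "half_agreement p r = (agreement p r + agreement p (- r)) div 2"

lemma agreement_minus_self: "p \<in> quadric \<Longrightarrow> agreement p (- p) = - 1"
proof -
  assume p: "p \<in> quadric"
  have "disc (p - - p) = 4 * n"
    using p by (simp only: disc_diff disc_minus polar_minus_right polar_self) (simp add: quadric_def)
  then show ?thesis
    unfolding agreement_def using uminus_quadric_neq[OF p]
    by (simp only: quad_char_mult quad_char_4 n_nonsquare) auto
qed

lemma half_agreement_self: "p \<in> H \<Longrightarrow> 2 * half_agreement p p = q - 1"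
  using agreement_minus_self[OF in_quadric, of p] odd_q by (simp add: half_agreement_def agreement_def)

lemma half_agreement_distinct:
  assumes p: "p \<in> H" and r: "r \<in> H" and neq: "p \<noteq> r"
  shows "2 * half_agreement p r = agreement p r + agreement p (- r)"
    and "odd (half_agreement p r) \<longleftrightarrow> quad_char (4 * n\<^sup>2 - (polar p r)\<^sup>2) = 1"
proof -
  have "disc (p - r) * disc (p + r) = 4 * n\<^sup>2 - (polar p r)\<^sup>2"
    using in_quadric[OF p] in_quadric[OF r]
    by (simp add: disc_diff disc_add quadric_def power2_eq_square algebra_simps)
  then have prod: "quad_char (4 * n\<^sup>2 - (polar p r)\<^sup>2) = quad_char (disc (p - r)) * quad_char (disc (p + r))"
    using quad_char_mult by metis
  have k: "agreement p r = quad_char (disc (p - r))" "agreement p (- r) = quad_char (disc (p + r))"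
    using neq H_neq_minus[OF p r] by (simp_all add: agreement_def)
  have "disc (p - r) \<noteq> 0" "disc (p + r) \<noteq> 0"
    using disc_diff_eq_0[of p r] disc_diff_eq_0[of p "- r"] neq H_neq_minus[OF p r] in_quadric p r uminus_quadric
    by auto
  then show "2 * half_agreement p r = agreement p r + agreement p (- r)"
      "odd (half_agreement p r) \<longleftrightarrow> quad_char (4 * n\<^sup>2 - (polar p r)\<^sup>2) = 1"
    unfolding prod half_agreement_def k
    by (cases "disc (p - r)" rule: quad_char_cases; cases "disc (p + r)" rule: quad_char_cases; simp)+
qed

lemma half_agreement: "p \<in> H \<Longrightarrow> r \<in> H \<Longrightarrow> 2 * half_agreement p r = agreement p r + agreement p (- r)"
  using half_agreement_distinct(1)[of p r] half_agreement_self[of p] agreement_minus_self[OF in_quadric, of p]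
  by (cases "p = r") (auto simp: agreement_def)

lemma half_agreement_commute: "half_agreement p r = half_agreement r p"
  by (simp add: half_agreement_def agreement_commute[of p r] agreement_commute[of p "- r"] agreement_minus_minus)

text \<open>The discriminants of \<open>p - r\<close> and \<open>p + r\<close> have the product \<open>4 n\<^sup>2 - (polar p r)\<^sup>2\<close>. Off the diagonal, \<open>F\<close> is
  half the sum of their two signs, hence odd exactly when the signs agree.\<close>

lemma half_agreement_mod_2:
  assumes p: "p \<in> H" and r: "r \<in> H" and neq: "p \<noteq> r"
  shows "[half_agreement p r = passant_joined p r + passant_size] (mod 2)"
proof -
  let ?d = "(polar p r)\<^sup>2 - 4 * n\<^sup>2"
  have "4 * n\<^sup>2 - (polar p r)\<^sup>2 = - ?d" by simp
  then have "odd (half_agreement p r) \<longleftrightarrow> quad_char (- 1 :: 'a) * quad_char ?d = 1"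
    using half_agreement_distinct(2)[OF assms] quad_char_minus[of ?d] by simp
  moreover have "quad_char (- 1 :: 'a) = (if even passant_size then - 1 else 1)"
    using even_passant_size_iff quad_char_minus_1 by auto
  moreover have "?d \<noteq> 0" using polar_square_neq in_quadric p r neq H_neq_minus by blast
  ultimately have "odd (half_agreement p r) \<longleftrightarrow> odd (passant_joined p r + passant_size)"
    by (cases ?d rule: quad_char_cases) (auto simp: passant_joined_def)
  then show ?thesis by (auto simp: cong_def mod2_eq_if)
qed

text \<open>The sign correlation is even or odd in \<open>r\<close> according to the sign of \<open>-1\<close>, so folding doubles it or kills it.\<close>

lemma half_agreement_square:
  assumes p: "p \<in> H" and r: "r \<in> H"
  shows "4 * (\<Sum>s\<in>H. half_agreement p s * half_agreement s r) =
    4 * q * half_agreement p r - (1 + quad_char (- 1 :: 'a)) * sign_correlation p r"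
proof -
  have "4 * (\<Sum>s\<in>H. half_agreement p s * half_agreement s r) = (\<Sum>s\<in>H. (2 * half_agreement p s) * (2 * half_agreement s r))"
    by (simp add: sum_distrib_left)
  also have "\<dots> = (\<Sum>s\<in>H. (agreement p s + agreement p (- s)) * (agreement s r + agreement s (- r)))"
    using p r by (intro sum.cong) (simp_all add: half_agreement)
  also have "\<dots> = (\<Sum>s\<in>quadric. agreement p s * (agreement s r + agreement s (- r)))"
    by (simp add: sum_quadric agreement_minus_minus algebra_simps)
  also have "\<dots> = (\<Sum>s\<in>quadric. agreement p s * agreement s r) + (\<Sum>s\<in>quadric. agreement p s * agreement s (- r))"
    by (simp add: distrib_left sum.distrib)
  also have "\<dots> = 2 * q * (agreement p r + agreement p (- r)) - (1 + quad_char (- 1 :: 'a)) * sign_correlation p r"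
    unfolding agreement_square[OF in_quadric[OF p] in_quadric[OF r]]
      agreement_square[OF in_quadric[OF p] uminus_quadric[OF in_quadric[OF r]]] sign_correlation_minus
    by (simp add: algebra_simps)
  also have "agreement p r + agreement p (- r) = 2 * half_agreement p r" using p r by (simp add: half_agreement)
  finally show ?thesis by simp
qed

lemma sign_correlation_half_agreement:
  assumes p: "p \<in> H" and r: "r \<in> H" and minus_1: "quad_char (- 1 :: 'a) = 1"
  shows "2 * (\<Sum>s\<in>H. sign_correlation p s * half_agreement s r) = (q + 1) * sign_correlation p r"
proof -
  have "2 * (\<Sum>s\<in>H. sign_correlation p s * half_agreement s r) = (\<Sum>s\<in>H. sign_correlation p s * (2 * half_agreement s r))"
    by (simp add: sum_distrib_left mult_ac)
  also have "\<dots> = (\<Sum>s\<in>H. sign_correlation p s * (agreement s r + agreement s (- r)))"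
    using r by (intro sum.cong) (simp_all add: half_agreement)
  also have "\<dots> = (\<Sum>s\<in>quadric. sign_correlation p s * agreement s r)"
    by (simp add: sum_quadric agreement_minus_minus sign_correlation_minus minus_1 algebra_simps)
  also have "\<dots> = (q + 1) * sign_correlation p r" using p r by (simp add: sign_correlation_agreement in_quadric)
  finally show ?thesis .
qed

text \<open>When \<open>-1\<close> is a non-square, folding has removed the sign correlation, and \<open>F\<close> itself is a lift.\<close>

lemma integral_idempotent_3_mod_4:
  assumes "even passant_size" and p: "p \<in> H" and r: "r \<in> H"
  shows "(\<Sum>s\<in>H. half_agreement p s * half_agreement s r) = q * half_agreement p r"
    and "[half_agreement p r = (if p = r then 1 else 0) + (\<Sum>s\<in>H. perp p s * perp s r)] (mod 2)"
proof -
  show "(\<Sum>s\<in>H. half_agreement p s * half_agreement s r) = q * half_agreement p r"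
    using half_agreement_square[OF p r] assms(1) even_passant_size_iff by simp
  show "[half_agreement p r = (if p = r then 1 else 0) + (\<Sum>s\<in>H. perp p s * perp s r)] (mod 2)"
  proof (cases "p = r")
    case True
    have "half_agreement p p = passant_size - 1" using half_agreement_self[OF p] two_passant_size by linarith
    then show ?thesis using True p r assms(1) passant_joined_self[OF p] by (simp add: perp_square cong_iff_dvd_diff)
  next
    case False
    have "[half_agreement p r = passant_joined p r + passant_size] (mod 2)" by (rule half_agreement_mod_2[OF p r False])
    also have "[passant_joined p r + passant_size = passant_joined p r] (mod 2)" using assms(1) by (simp add: cong_iff_dvd_diff)
    finally show ?thesis using False p r by (simp add: perp_square)
  qed
qed

text \<open>The matrix \<open>q F - F\<^sup>2\<close>. When \<open>-1\<close> is a square, it is half the sign correlation and \<open>F\<close> acts on it as \<open>(q + 1) / 2\<close>.\<close>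

definition agreement_defect :: "'a ^ 3 \<Rightarrow> 'a ^ 3 \<Rightarrow> int" where
  "agreement_defect p r = q * half_agreement p r - (\<Sum>s\<in>H. half_agreement p s * half_agreement s r)"

text \<open>This is the product \<open>(F - q) (F - (q + 1) / 2)\<close>, with \<open>F\<^sup>2\<close> eliminated. When \<open>-1\<close> is a square, it is a multiple of the
  projection onto the functions with zero sum over every unipotent orbit.\<close>

definition cuspidal :: "'a ^ 3 \<Rightarrow> 'a ^ 3 \<Rightarrow> int" where
  "cuspidal p r = (if p = r then q * passant_size else 0) - passant_size * half_agreement p r - agreement_defect p r"

lemma agreement_defect_eq:
  assumes "odd passant_size" "p \<in> H" "r \<in> H"
  shows "2 * agreement_defect p r = sign_correlation p r"
proof -
  show ?thesis
    using half_agreement_square[OF assms(2,3)] quad_char_minus_1_eq_1[OF assms(1)] by (simp add: agreement_defect_def)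
qed

lemma cuspidal_square:
  assumes passant_size: "odd passant_size" and p: "p \<in> H" and r: "r \<in> H"
  shows "(\<Sum>s\<in>H. cuspidal p s * cuspidal s r) = (q * passant_size) * cuspidal p r"
proof -
  have minus_1: "quad_char (- 1 :: 'a) = 1" by (rule quad_char_minus_1_eq_1[OF passant_size])
  have FF: "(\<Sum>s\<in>H. half_agreement p s * half_agreement s r) = q * half_agreement p r - agreement_defect p r" for p r
    by (simp add: agreement_defect_def)
  have NF: "(\<Sum>s\<in>H. agreement_defect p s * half_agreement s r) = passant_size * agreement_defect p r" if "p \<in> H" "r \<in> H" for p r
  proof -
    have "4 * (\<Sum>s\<in>H. agreement_defect p s * half_agreement s r) = 2 * (\<Sum>s\<in>H. (2 * agreement_defect p s) * half_agreement s r)"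
      by (simp add: sum_distrib_left mult.assoc)
    also have "\<dots> = 2 * (\<Sum>s\<in>H. sign_correlation p s * half_agreement s r)"
      using that agreement_defect_eq[OF passant_size] by simp
    also have "\<dots> = (q + 1) * (2 * agreement_defect p r)"
      using that by (simp add: sign_correlation_half_agreement minus_1 agreement_defect_eq[OF passant_size])
    also have "\<dots> = 4 * (passant_size * agreement_defect p r)"
      by (simp only: two_passant_size[symmetric])
    finally show ?thesis by simp
  qed
  have N_comm: "agreement_defect p r = agreement_defect r p" for p r
  proof -
    have "(\<Sum>s\<in>H. half_agreement p s * half_agreement s r) = (\<Sum>s\<in>H. half_agreement r s * half_agreement s p)"
      by (rule sum.cong[OF refl]) (metis half_agreement_commute mult.commute)
    then show ?thesis unfolding agreement_defect_def using half_agreement_commute[of p r] by simp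
  qed
  have FN: "(\<Sum>s\<in>H. half_agreement p s * agreement_defect s r) = passant_size * agreement_defect p r"
  proof -
    have "(\<Sum>s\<in>H. half_agreement p s * agreement_defect s r) = (\<Sum>s\<in>H. agreement_defect r s * half_agreement s p)"
      by (rule sum.cong[OF refl]) (metis half_agreement_commute N_comm mult.commute)
    then show ?thesis using NF[OF r p] N_comm by simp
  qed
  have NN: "(\<Sum>s\<in>H. agreement_defect p s * agreement_defect s r) = passant_size * (q - passant_size) * agreement_defect p r"
  proof -
    have "(\<Sum>s\<in>H. agreement_defect p s * agreement_defect s r) =
        q * (\<Sum>s\<in>H. agreement_defect p s * half_agreement s r) - (\<Sum>s\<in>H. agreement_defect p s * (\<Sum>t\<in>H. half_agreement s t * half_agreement t r))"
      unfolding sum_distrib_left sum_subtractf[symmetric]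
      by (rule sum.cong) (simp_all add: agreement_defect_def[of _ r] algebra_simps sum_distrib_left)
    also have "(\<Sum>s\<in>H. agreement_defect p s * (\<Sum>t\<in>H. half_agreement s t * half_agreement t r)) =
        (\<Sum>t\<in>H. (\<Sum>s\<in>H. agreement_defect p s * half_agreement s t) * half_agreement t r)"
      by (simp add: sum_distrib_left sum_distrib_right mult.assoc) (rule sum.swap)
    also have "\<dots> = (\<Sum>t\<in>H. passant_size * (agreement_defect p t * half_agreement t r))"
      using p by (intro sum.cong) (simp_all add: NF)
    also have "\<dots> = passant_size * (passant_size * agreement_defect p r)"
      using p r by (simp add: NF flip: sum_distrib_left)
    finally show ?thesis unfolding NF[OF p r] by (simp add: algebra_simps)
  qed
  let ?F = half_agreement and ?N = agreement_defect
  have "(\<Sum>s\<in>H. cuspidal p s * cuspidal s r) =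
      (\<Sum>s\<in>H. (if p = s then q * passant_size * cuspidal s r else 0) - (if s = r then q * passant_size * (passant_size * ?F p s + ?N p s) else 0)
        + passant_size\<^sup>2 * (?F p s * ?F s r) + passant_size * (?F p s * ?N s r) + passant_size * (?N p s * ?F s r) + ?N p s * ?N s r)"
    by (rule sum.cong) (auto simp: cuspidal_def power2_eq_square algebra_simps)
  also have "\<dots> = q * passant_size * cuspidal p r - q * passant_size * (passant_size * ?F p r + ?N p r)
      + passant_size\<^sup>2 * (q * ?F p r - ?N p r) + passant_size * (passant_size * ?N p r) + passant_size * (passant_size * ?N p r) + passant_size * (q - passant_size) * ?N p r"
    using p r by (simp add: sum.distrib sum_subtractf FF NF FN NN flip: sum_distrib_left)
  also have "\<dots> = (q * passant_size) * cuspidal p r"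
    by (simp add: power2_eq_square algebra_simps)
  finally show ?thesis .
qed

text \<open>If \<open>(q + 1) / 2\<close> is odd, then modulo \<open>2\<close> one has \<open>F = J + A\<^sup>2\<close> with the all-one matrix \<open>J\<close>. Here \<open>J\<^sup>2 = 0\<close> because the number of internal points
  is even, \<open>J\<close> commutes with \<open>A\<^sup>2\<close>, and \<open>A\<^sup>4 = A\<^sup>2\<close>.\<close>

lemma half_agreement_square_mod_2:
  assumes passant_size: "odd passant_size" and p: "p \<in> H" and r: "r \<in> H"
  shows "[(\<Sum>s\<in>H. half_agreement p s * half_agreement s r) = (\<Sum>s\<in>H. perp p s * perp s r)] (mod 2)"
proof -
  define B where "B p r = (\<Sum>s\<in>H. perp p s * perp s r)" for p r
  have F: "[half_agreement p r = 1 + B p r] (mod 2)" if "p \<in> H" "r \<in> H" for p r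
  proof (cases "p = r")
    case True
    have "half_agreement p p = passant_size - 1" using half_agreement_self[of p] two_passant_size that by linarith
    then show ?thesis using True passant_size that passant_joined_self[of p] by (simp add: B_def perp_square cong_iff_dvd_diff)
  next
    case False
    have "[half_agreement p r = passant_joined p r + passant_size] (mod 2)" by (rule half_agreement_mod_2[OF that False])
    also have "[passant_joined p r + passant_size = 1 + B p r] (mod 2)"
      using passant_size False that by (simp add: B_def perp_square cong_iff_dvd_diff)
    finally show ?thesis .
  qed
  have row: "(\<Sum>s\<in>H. B p s) = passant_size * passant_size" if "p \<in> H" for p
  proof -
    have "(\<Sum>s\<in>H. B p s) = (\<Sum>t\<in>H. perp p t * (\<Sum>s\<in>H. perp t s))"
      unfolding B_def by (subst sum.swap) (simp add: sum_distrib_left)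
    then show ?thesis using that by (simp add: sum_perp flip: sum_distrib_right)
  qed
  have B_comm: "B p r = B r p" for p r
    unfolding B_def by (simp add: perp_commute[of p] perp_commute[of _ r] mult.commute)
  have BB: "[(\<Sum>s\<in>H. B p s * B s r) = B p r] (mod 2)"
  proof -
    have "(\<Sum>s\<in>H. B p s * B s r) = (\<Sum>t\<in>H. perp p t * (\<Sum>s\<in>H. perp t s * B s r))"
      unfolding B_def[of p] by (simp add: sum_distrib_left sum_distrib_right mult.assoc) (rule sum.swap)
    also have "[\<dots> = (\<Sum>t\<in>H. perp p t * perp t r)] (mod 2)"
      unfolding B_def using r by (intro cong_sum cong_mult cong_refl perp_cube)
    finally show ?thesis by (simp add: B_def)
  qed
  have even_H: "even (int (card H))"
  proof -
    obtain k where k: "passant_size = 2 * k + 1" using passant_size by (auto elim: oddE)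
    then have "q = 4 * k + 1" using two_passant_size by linarith
    then have "2 * int (card H) = 2 * (2 * ((4 * k + 1) * k))" using card_H by (simp add: algebra_simps)
    then have "int (card H) = 2 * ((4 * k + 1) * k)" by simp
    then show ?thesis by simp
  qed
  have "[(\<Sum>s\<in>H. half_agreement p s * half_agreement s r) = (\<Sum>s\<in>H. (1 + B p s) * (1 + B s r))] (mod 2)"
    using p r by (intro cong_sum cong_mult F)
  also have "(\<Sum>s\<in>H. (1 + B p s) * (1 + B s r)) = int (card H) + (\<Sum>s\<in>H. B p s) + (\<Sum>s\<in>H. B r s) + (\<Sum>s\<in>H. B p s * B s r)"
    by (simp add: algebra_simps sum.distrib B_comm[of _ r])
  also have "\<dots> = (int (card H) + 2 * (passant_size * passant_size)) + (\<Sum>s\<in>H. B p s * B s r)"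
    using p r by (simp add: row)
  also have "[\<dots> = 0 + B p r] (mod 2)"
    using even_H by (intro cong_add BB) (simp add: cong_0_iff)
  finally show ?thesis by (simp add: B_def)
qed

lemma cuspidal_mod_2:
  assumes passant_size: "odd passant_size" and p: "p \<in> H" and r: "r \<in> H"
  shows "[cuspidal p r = (if p = r then 1 else 0) + (\<Sum>s\<in>H. perp p s * perp s r)] (mod 2)"
proof -
  let ?FF = "\<Sum>s\<in>H. half_agreement p s * half_agreement s r"
  have "cuspidal p r = (if p = r then q * passant_size else 0) - (passant_size + q) * half_agreement p r + ?FF"
    by (simp add: cuspidal_def agreement_defect_def algebra_simps)
  also have "[\<dots> = (if p = r then 1 else 0) - 0 + ?FF] (mod 2)"
    using passant_size odd_q by (intro cong_add cong_diff) (auto simp: cong_iff_dvd_diff)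
  also have "[(if p = r then 1 else 0) - 0 + ?FF = (if p = r then 1 else 0) + (\<Sum>s\<in>H. perp p s * perp s r)] (mod 2)"
    using half_agreement_square_mod_2[OF assms] by (intro cong_add) auto
  finally show ?thesis .
qed

text \<open>The two lifts have constant diagonals, so their traces follow from the number of internal points.\<close>

lemma dim_null_space_perp:
  fixes I :: "'i set" and rep :: "'i \<Rightarrow> 'a ^ 3"
  assumes bij: "bij_betw rep I H"
  shows "4 * int (fun_space.dim (null_space I I (\<lambda>i j. of_int (perp (rep i) (rep j)) :: bit))) = (q - 1)\<^sup>2"
proof -
  have fin: "finite I" using bij_betw_finite[OF bij] by simp
  have rep: "rep i \<in> H" if "i \<in> I" for i using bij that bij_betwE by blast
  have rep_eq: "rep i = rep j \<longleftrightarrow> i = j" if "i \<in> I" "j \<in> I" for i j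
    using bij that by (metis bij_betw_def inj_onD)
  have re: "(\<Sum>i\<in>I. g (rep i)) = (\<Sum>p\<in>H. g p)" for g :: "'a ^ 3 \<Rightarrow> int"
    by (rule sum.reindex_bij_betw[OF bij])
  let ?d = "int (fun_space.dim (null_space I I (\<lambda>i j. of_int (perp (rep i) (rep j)) :: bit)))"
  have "card {0, 1 :: 'a} \<le> CARD('a)" by (rule card_mono) auto
  moreover have "card {0, 1 :: 'a} = 2" by simp
  ultimately have "int 2 \<le> int CARD('a)" by (simp only: of_nat_le_iff)
  then have q1: "q > 1" by simp
  have dim: "c * ?d = (\<Sum>p\<in>H. G p p)"
    if "\<And>p r. p \<in> H \<Longrightarrow> r \<in> H \<Longrightarrow> [G p r = (if p = r then 1 else 0) + (\<Sum>s\<in>H. perp p s * perp s r)] (mod 2)"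
      "\<And>p r. p \<in> H \<Longrightarrow> r \<in> H \<Longrightarrow> (\<Sum>s\<in>H. G p s * G s r) = c * G p r" "c > 0" "odd c" for G c
  proof -
    have "c * ?d = (\<Sum>i\<in>I. G (rep i) (rep i))"
    proof (rule dim_null_space_mod_2[OF fin, where G = "\<lambda>i j. G (rep i) (rep j)" and A = "\<lambda>i j. perp (rep i) (rep j)"])
      fix i j assume ij: "i \<in> I" "j \<in> I"
      show "[(\<Sum>k\<in>I. perp (rep i) (rep k) * (\<Sum>l\<in>I. perp (rep k) (rep l) * perp (rep l) (rep j))) = perp (rep i) (rep j)] (mod 2)"
        using perp_cube[OF rep[OF ij(1)] rep[OF ij(2)]]
        by (simp add: re[of "\<lambda>l. perp _ l * perp l _"] re[of "\<lambda>k. perp _ k * (\<Sum>l\<in>H. perp k l * perp l _)"])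
      show "[G (rep i) (rep j) = (if i = j then 1 else 0) + (\<Sum>k\<in>I. perp (rep i) (rep k) * perp (rep k) (rep j))] (mod 2)"
        using that(1)[OF rep[OF ij(1)] rep[OF ij(2)]] rep_eq[OF ij] by (simp add: re[of "\<lambda>l. perp _ l * perp l _"])
      show "(\<Sum>k\<in>I. G (rep i) (rep k) * G (rep k) (rep j)) = c * G (rep i) (rep j)"
        using that(2)[OF rep[OF ij(1)] rep[OF ij(2)]] by (simp add: re[of "\<lambda>k. G _ k * G k _"])
    qed (use that in auto)
    then show ?thesis by (simp add: re[of "\<lambda>p. G p p"])
  qed
  show ?thesis
  proof (cases "even passant_size")
    case True
    have "q * ?d = (\<Sum>p\<in>H. half_agreement p p)"
      using q1 odd_q
      by (intro dim[where G = half_agreement and c = q] integral_idempotent_3_mod_4[OF True]) simp_all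
    then have "q * (4 * ?d) = 2 * (\<Sum>p\<in>H. 2 * half_agreement p p)"
      by (simp flip: sum_distrib_left)
    also have "\<dots> = (2 * int (card H)) * (q - 1)" by (simp add: half_agreement_self)
    also have "\<dots> = q * (q - 1)\<^sup>2" by (simp add: card_H power2_eq_square)
    finally show ?thesis using q1 by simp
  next
    case False
    have dim_eq: "(q * passant_size) * ?d = (\<Sum>p\<in>H. cuspidal p p)"
      using q1 odd_q False two_passant_size
      by (intro dim[where G = cuspidal and c = "q * passant_size"] cuspidal_square[OF False] cuspidal_mod_2[OF False]) simp_all
    have "2 * cuspidal p p = passant_size * (q - 1)" if "p \<in> H" for p
    proof -
      have "2 * agreement_defect p p = q + 1" using agreement_defect_eq[OF False that that] sign_correlation_self[OF in_quadric[OF that]] by simp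
      then have "2 * cuspidal p p = q * (2 * passant_size) - passant_size * (2 * half_agreement p p) - 2 * passant_size"
        using two_passant_size by (simp add: cuspidal_def algebra_simps)
      then show ?thesis using half_agreement_self[OF that] by (simp add: algebra_simps)
    qed
    then have trace: "2 * (\<Sum>p\<in>H. cuspidal p p) = int (card H) * (passant_size * (q - 1))"
      by (simp add: sum_distrib_left)
    have "(q * passant_size) * (4 * ?d) = 2 * (2 * ((q * passant_size) * ?d))" by simp
    also have "\<dots> = 2 * (int (card H) * (passant_size * (q - 1)))" unfolding dim_eq trace ..
    also have "\<dots> = (2 * int (card H)) * (passant_size * (q - 1))" by simp
    also have "\<dots> = (q * passant_size) * (q - 1)\<^sup>2" by (simp add: card_H power2_eq_square)
    finally have "(q * passant_size) * (4 * ?d) = (q * passant_size) * (q - 1)\<^sup>2" .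
    moreover have "passant_size \<noteq> 0" using two_passant_size q1 by auto
    ultimately show ?thesis using q1 by simp
  qed
qed

end

section \<open>Passant lines and internal points\<close>

lemma proj_class_eq_iff:
  fixes v w :: "'a::field ^ 3"
  assumes "v \<noteq> 0" "w \<noteq> 0"
  shows "proj_class v = proj_class w \<longleftrightarrow> (\<exists>c. c \<noteq> 0 \<and> w = c *s v)"
  using assms eq_equiv_class_iff[OF equiv_proj_rel, of v w]
  by (simp add: proj_class_def) (simp add: proj_rel_def)

lemma pg_points_eq: "pg_points = proj_class ` {v. v \<noteq> 0}"
  and pg_lines_eq: "pg_lines = proj_class ` {v. v \<noteq> 0}"
  by (auto simp: pg_points_def pg_lines_def quotient_def proj_class_def)

text \<open>The parametrization of the conic by the projective line for which pairing a vector with the conic point of \<open>l\<close>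
  evaluates its form at \<open>l\<close>, up to sign.\<close>

definition conic_point :: "'a::field \<times> 'a \<Rightarrow> 'a ^ 3" where
  "conic_point = (\<lambda>(x, y). vector [y\<^sup>2, - (x * y), x\<^sup>2])"

text \<open>The pole of a line with respect to the conic, scaled so that pairing with it is exactly the linear form of the line.\<close>

definition line_pole :: "'a::field ^ 3 \<Rightarrow> 'a ^ 3" where
  "line_pole w = vector [- (w $ 3), w $ 2 / 2, - (w $ 1)]"

lemma conic_point_neq_0: "l \<in> proj_line \<Longrightarrow> conic_point l \<noteq> 0"
  by (auto simp: proj_line_def conic_point_def vec_eq_iff forall_3)

lemma disc_conic_point: "disc (conic_point l) = 0"
  by (cases l) (simp add: conic_point_def disc_def power2_eq_square)

lemma polar_conic_point: "polar p (conic_point l) = - binary_form p l"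
  by (cases l) (simp add: conic_point_def polar_def binary_form.simps algebra_simps)

lemma conic_points_eq: "conic_points = (\<lambda>l. proj_class (conic_point l)) ` proj_line"
proof -
  have "range (\<lambda>r. proj_class (vector [1, r, r\<^sup>2] :: 'a::field ^ 3)) = range (\<lambda>s. proj_class (conic_point (s, 1)))"
  proof (intro equalityI subsetI; elim rangeE)
    fix P and r :: 'a assume "P = proj_class (vector [1, r, r\<^sup>2] :: 'a ^ 3)"
    then have "P = proj_class (conic_point (- r, 1))" by (simp add: conic_point_def)
    then show "P \<in> range (\<lambda>s. proj_class (conic_point (s :: 'a, 1)))" by blast
  next
    fix P and s :: 'a assume "P = proj_class (conic_point (s, 1))"
    then have "P = proj_class (vector [1, - s, (- s)\<^sup>2])" by (simp add: conic_point_def)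
    then show "P \<in> range (\<lambda>r. proj_class (vector [1, r, r\<^sup>2] :: 'a ^ 3))" by blast
  qed
  moreover have "conic_point (1, 0) = vector [0, 0, 1 :: 'a]" by (simp add: conic_point_def)
  ultimately show ?thesis unfolding conic_points_def proj_line_def by (simp add: image_image)
qed

lemma inj_conic_point: "inj_on (\<lambda>l. proj_class (conic_point l)) proj_line"
proof (rule inj_onI)
  fix l l' :: "'a::field \<times> 'a"
  assume l: "l \<in> proj_line" "l' \<in> proj_line" and "proj_class (conic_point l) = proj_class (conic_point l')"
  then obtain c where "c \<noteq> 0" "conic_point l' = c *s conic_point l"
    using proj_class_eq_iff[OF conic_point_neq_0[OF l(1)] conic_point_neq_0[OF l(2)]] by auto
  then show "l = l'"
    using l by (auto simp: proj_line_def conic_point_def vec_eq_iff forall_3)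
qed

context odd_finite_field
begin

lemma polar_line_pole: "polar (line_pole w) v = v $ 1 * w $ 1 + v $ 2 * w $ 2 + v $ (3 :: 3) * (w $ 3 :: 'a)"
  using two_neq_0 by (simp add: polar_def line_pole_def algebra_simps)

lemma line_pole_surj: "\<exists>w. line_pole w = (p :: 'a ^ 3)"
proof
  show "line_pole (vector [- (p $ 3), 2 * p $ 2, - (p $ 1)]) = p"
    using two_neq_0 by (simp add: line_pole_def vec_eq_iff forall_3)
qed

lemma line_pole_eq_0_iff: "line_pole w = 0 \<longleftrightarrow> w = (0 :: 'a ^ 3)"
  using two_neq_0 by (auto simp: line_pole_def vec_eq_iff forall_3)

lemma incident_iff_polar:
  fixes v w :: "'a ^ 3"
  assumes "v \<noteq> 0" "w \<noteq> 0"
  shows "incident (proj_class v) (proj_class w) \<longleftrightarrow> polar (line_pole w) v = 0"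
  using assms by (simp add: incident_proj_class polar_line_pole)

lemma card_conic_on_line_eq_zeros:
  fixes w :: "'a ^ 3"
  assumes "w \<noteq> 0"
  shows "card {P \<in> conic_points. incident P (proj_class w)} = card {l \<in> proj_line. binary_form (line_pole w) l = 0}"
proof -
  have "{P \<in> conic_points. incident P (proj_class w)} =
      (\<lambda>l. proj_class (conic_point l)) ` {l \<in> proj_line. binary_form (line_pole w) l = 0}"
    using assms by (auto simp: conic_points_eq incident_iff_polar conic_point_neq_0 polar_conic_point)
  moreover have "inj_on (\<lambda>l. proj_class (conic_point l)) {l \<in> proj_line. binary_form (line_pole w) l = 0}"
    by (rule inj_on_subset[OF inj_conic_point]) auto
  ultimately show ?thesis by (simp add: card_image)
qed

end

context nonsplit_quadric
begin

text \<open>A line meets the conic in the points that correspond to the zeros of the form of its pole.\<close>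

lemma card_conic_on_line:
  fixes w :: "'a ^ 3"
  assumes "w \<noteq> 0"
  shows "int (card {P \<in> conic_points. incident P (proj_class w)}) = 1 + quad_char (disc (line_pole w))"
  using card_binary_form_zeros[of "line_pole w"] assms
  by (simp add: card_conic_on_line_eq_zeros sum_If_1_0 line_pole_eq_0_iff)

lemma passant_iff:
  "w \<noteq> (0 :: 'a ^ 3) \<Longrightarrow> proj_class w \<in> passant_lines \<longleftrightarrow> quad_char (disc (line_pole w)) = - 1"
proof -
  assume w: "w \<noteq> 0"
  then have "proj_class w \<in> passant_lines \<longleftrightarrow>
      int (card {P \<in> conic_points. incident P (proj_class w)}) = 0"
    by (auto simp: passant_lines_def pg_lines_eq)
  then show ?thesis unfolding card_conic_on_line[OF w] by linarith
qed

lemma tangent_iff: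
  "w \<noteq> (0 :: 'a ^ 3) \<Longrightarrow> proj_class w \<in> tangent_lines \<longleftrightarrow> disc (line_pole w) = 0"
  using card_conic_on_line[of w] by (auto simp: tangent_lines_def pg_lines_eq)

text \<open>The tangents through a point correspond to the zeros of its form on the projective line. A form without zeros has
  a non-square discriminant; a point of the conic has discriminant zero and lies on its own tangent.\<close>

lemma internal_iff:
  assumes v: "v \<noteq> (0 :: 'a ^ 3)"
  shows "proj_class v \<in> internal_points \<longleftrightarrow> quad_char (disc v) = - 1"
proof
  assume "proj_class v \<in> internal_points"
  then have none: "{l \<in> tangent_lines. incident (proj_class v) l} = {}"
    by (simp add: internal_points_def)
  show "quad_char (disc v) = - 1"
  proof (rule ccontr)
    assume "quad_char (disc v) \<noteq> - 1"
    then have "quad_char (disc v) \<ge> 0" by (cases "disc v" rule: quad_char_cases) auto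
    moreover have "int (card {l \<in> proj_line. binary_form v l = 0}) = 1 + quad_char (disc v)"
      using card_binary_form_zeros[of v] v by (simp add: sum_If_1_0)
    ultimately have "card {l \<in> proj_line. binary_form v l = 0} \<noteq> 0" by linarith
    then obtain l where l: "l \<in> proj_line" "binary_form v l = 0"
      by (metis (mono_tags, lifting) card.empty empty_Collect_eq)
    obtain w where w: "line_pole w = conic_point l" using line_pole_surj by blast
    then have w0: "w \<noteq> 0" using conic_point_neq_0[OF l(1)] line_pole_eq_0_iff by metis
    have "proj_class w \<in> tangent_lines" using w0 by (simp add: tangent_iff w disc_conic_point)
    moreover have "incident (proj_class v) (proj_class w)"
      using l v w0 by (simp add: incident_iff_polar w polar_commute[of "conic_point l"] polar_conic_point)
    ultimately show False using none by blast
  qed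
next
  assume qc: "quad_char (disc v) = - 1"
  interpret v: nonsplit_quadric ty "disc v" q
    by unfold_locales (use qc in auto)
  have vq: "v \<in> v.quadric" by (simp add: v.quadric_def)
  have "\<not> incident (proj_class v) L" if "L \<in> tangent_lines" for L
  proof -
    obtain w where w: "L = proj_class w" "w \<noteq> 0" using \<open>L \<in> tangent_lines\<close> by (auto simp: tangent_lines_def pg_lines_eq)
    then have "disc (line_pole w) = 0" using tangent_iff \<open>L \<in> tangent_lines\<close> by simp
    then show ?thesis
      using v.polar_isotropic_neq_0[OF vq, of "line_pole w"] v w
      by (simp add: incident_iff_polar line_pole_eq_0_iff polar_commute[of "line_pole w"])
  qed
  then have "{L \<in> tangent_lines. incident (proj_class v) L} = {}" by blast
  moreover have "proj_class v \<notin> conic_points"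
  proof
    assume "proj_class v \<in> conic_points"
    then obtain l where l: "l \<in> proj_line" "proj_class v = proj_class (conic_point l)" by (auto simp: conic_points_eq)
    then obtain c where "c \<noteq> 0" "conic_point l = c *s v"
      using proj_class_eq_iff[OF v conic_point_neq_0[OF l(1)]] by auto
    then have "c\<^sup>2 * disc v = 0" using disc_conic_point[of l] by (simp add: disc_scale)
    then show False using qc \<open>c \<noteq> 0\<close> by auto
  qed
  ultimately show "proj_class v \<in> internal_points"
    using v by (simp add: internal_points_def pg_points_eq)
qed

definition rep :: "('a ^ 3) set \<Rightarrow> 'a ^ 3" where
  "rep P = (SOME p. p \<in> quadric \<and> proj_class p = P)"

lemma normalize:
  assumes "v \<noteq> 0" "quad_char (disc v) = - 1"
  obtains c where "c \<noteq> 0" "c *s v \<in> quadric" "proj_class (c *s v) = proj_class v"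
proof -
  have "quad_char (n / disc v) = 1" using assms n_nonsquare by (simp add: quad_char_divide)
  then obtain c where c: "n / disc v = c\<^sup>2" by (auto simp: quad_char_def split: if_splits)
  have c0: "c \<noteq> 0" using c n_neq_0 assms by auto
  have "disc v \<noteq> 0" using assms by auto
  then have "c *s v \<in> quadric" by (simp add: quadric_def disc_scale flip: c)
  moreover have "c *s v \<noteq> 0" using c0 assms by simp
  then have "proj_class v = proj_class (c *s v)" using proj_class_eq_iff[OF assms(1)] c0 by blast
  ultimately show thesis using that c0 by simp
qed

lemma rep:
  assumes "P \<in> internal_points"
  shows "rep P \<in> quadric" "proj_class (rep P) = P"
proof -
  obtain v where v: "P = proj_class v" "v \<noteq> 0" using assms by (auto simp: internal_points_def pg_points_eq)
  then have "quad_char (disc v) = - 1" using internal_iff assms by simp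
  then have "\<exists>p. p \<in> quadric \<and> proj_class p = P" using normalize[OF v(2)] v(1) by metis
  then have "rep P \<in> quadric \<and> proj_class (rep P) = P" unfolding rep_def by (rule someI_ex)
  then show "rep P \<in> quadric" "proj_class (rep P) = P" by auto
qed

lemma proj_class_internal: "p \<in> quadric \<Longrightarrow> proj_class p \<in> internal_points"
  using internal_iff[OF quadric_neq_0] n_nonsquare by (simp add: quadric_def)

lemma proj_class_quadric_eq:
  assumes "p \<in> quadric" "r \<in> quadric" "proj_class p = proj_class r"
  shows "r = p \<or> r = - p"
proof -
  obtain c where c: "r = c *s p" using assms proj_class_eq_iff quadric_neq_0 by metis
  then have "c\<^sup>2 = 1" using assms n_neq_0 by (simp add: quadric_def disc_scale)
  then have "c = 1 \<or> c = - 1" by (simp add: power2_eq_1_iff)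
  then show ?thesis using c by auto
qed

lemma half_quadric_rep: "half_quadric n q (rep ` internal_points)"
proof unfold_locales
  have minus: "proj_class (- p) = proj_class p" if "p \<in> quadric" for p
    using that quadric_neq_0[OF that] uminus_quadric proj_class_eq_iff[of p "- p"]
    by (auto intro!: exI[of _ "- 1"])
  show "quadric = rep ` internal_points \<union> uminus ` rep ` internal_points"
  proof (intro equalityI subsetI)
    fix p assume p: "p \<in> quadric"
    have "p = rep (proj_class p) \<or> p = - rep (proj_class p)"
      using rep[OF proj_class_internal[OF p]] p proj_class_quadric_eq by blast
    then show "p \<in> rep ` internal_points \<union> uminus ` rep ` internal_points"
      using proj_class_internal[OF p] by blast
  qed (use rep uminus_quadric in auto)
  show "rep ` internal_points \<inter> uminus ` rep ` internal_points = {}"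
  proof (rule ccontr)
    assume "rep ` internal_points \<inter> uminus ` rep ` internal_points \<noteq> {}"
    then obtain P P' where P: "P \<in> internal_points" "P' \<in> internal_points" "rep P = - rep P'" by blast
    then have "P = P'" using rep minus by metis
    then show False using P uminus_quadric_neq rep by metis
  qed
qed

lemma incidence_matrix_eq_perp:
  assumes w: "w \<noteq> 0" and c: "c \<noteq> 0" and P: "P \<in> internal_points"
  shows "incidence_matrix (proj_class w) P = of_int (perp (c *s line_pole w) (rep P))"
proof -
  have "incident P (proj_class w) \<longleftrightarrow> polar (line_pole w) (rep P) = 0"
    using incident_iff_polar[OF quadric_neq_0 w] rep[OF P] by metis
  then show ?thesis using c by (simp add: incidence_matrix_def perp_def polar_scale_left)
qed

text \<open>The null space depends only on the set of rows of the matrix, and taking poles identifies the rows indexed by passant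
  lines with those of the conjugacy matrix.\<close>

lemma null_space_incidence_eq:
  "null_space passant_lines internal_points (incidence_matrix :: ('a ^ 3) set \<Rightarrow> ('a ^ 3) set \<Rightarrow> bit) =
   null_space internal_points internal_points (\<lambda>i j. of_int (perp (rep i) (rep j)))"
proof -
  have 1: "\<exists>i\<in>internal_points. \<forall>j\<in>internal_points. incidence_matrix l j = (of_int (perp (rep i) (rep j)) :: bit)"
    if l: "l \<in> passant_lines" for l :: "('a ^ 3) set"
  proof -
    obtain w where w: "l = proj_class w" "w \<noteq> 0" using l by (auto simp: passant_lines_def pg_lines_eq)
    define s where "s = line_pole w"
    have s: "s \<noteq> 0" "quad_char (disc s) = - 1"
      using w l passant_iff by (auto simp: s_def line_pole_eq_0_iff)
    define i where "i = proj_class s"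
    have i: "i \<in> internal_points" using s by (simp add: i_def internal_iff)
    have "proj_class s = proj_class (rep i)" using rep[OF i] by (simp add: i_def)
    then obtain c where c: "c \<noteq> 0" "rep i = c *s s"
      using proj_class_eq_iff[OF s(1) quadric_neq_0[OF rep(1)[OF i]]] by auto
    have "incidence_matrix l j = of_int (perp (rep i) (rep j))" if "j \<in> internal_points" for j
      unfolding w(1) c(2) s_def by (rule incidence_matrix_eq_perp[OF w(2) c(1) that])
    then show ?thesis using i by blast
  qed
  have 2: "\<exists>l\<in>passant_lines. \<forall>j\<in>internal_points. incidence_matrix l j = (of_int (perp (rep i) (rep j)) :: bit)"
    if i: "i \<in> internal_points" for i
  proof -
    obtain w where w: "line_pole w = rep i" using line_pole_surj by blast
    have ri: "rep i \<in> quadric" using rep[OF i] by simp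
    have w0: "w \<noteq> 0" using w quadric_neq_0[OF ri] line_pole_eq_0_iff by metis
    have "proj_class w \<in> passant_lines"
      using w0 ri n_nonsquare by (simp add: passant_iff w quadric_def)
    moreover have "incidence_matrix (proj_class w) j = of_int (perp (rep i) (rep j))" if "j \<in> internal_points" for j
      using incidence_matrix_eq_perp[OF w0, of 1 j] that by (simp add: w)
    ultimately show ?thesis by blast
  qed
  have "(\<forall>l\<in>passant_lines. (\<Sum>j\<in>internal_points. incidence_matrix l j * x j) = 0) \<longleftrightarrow>
      (\<forall>i\<in>internal_points. (\<Sum>j\<in>internal_points. of_int (perp (rep i) (rep j)) * x j) = 0)"
    for x :: "('a ^ 3) set \<Rightarrow> bit"
  proof (intro iffI ballI)
    fix i :: "('a ^ 3) set"
    assume h: "\<forall>l\<in>(passant_lines :: ('a ^ 3) set set). (\<Sum>j\<in>internal_points. incidence_matrix l j * x j) = 0" and i: "i \<in> internal_points"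
    obtain l where "l \<in> passant_lines" "\<And>j. j \<in> internal_points \<Longrightarrow> incidence_matrix l j = of_int (perp (rep i) (rep j))"
      using 2[OF i] by blast
    then have "(\<Sum>j\<in>internal_points. of_int (perp (rep i) (rep j)) * x j) =
        (\<Sum>j\<in>internal_points. incidence_matrix l j * x j)" "l \<in> passant_lines"
      by simp_all
    then show "(\<Sum>j\<in>internal_points. of_int (perp (rep i) (rep j)) * x j) = 0" using h by simp
  next
    fix l assume h: "\<forall>i\<in>(internal_points :: ('a ^ 3) set set). (\<Sum>j\<in>internal_points. of_int (perp (rep i) (rep j)) * x j) = 0"
      and l: "l \<in> (passant_lines :: ('a ^ 3) set set)"
    obtain i where "i \<in> internal_points" "\<And>j. j \<in> internal_points \<Longrightarrow> incidence_matrix l j = of_int (perp (rep i) (rep j))"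
      using 1[OF l] by blast
    then show "(\<Sum>j\<in>internal_points. incidence_matrix l j * x j) = 0" using h by simp
  qed
  then show ?thesis by (auto simp: null_space_def)
qed

lemma dim_null_space_incidence:
  "4 * int (fun_space.dim (null_space passant_lines (internal_points :: ('a ^ 3) set set) incidence_matrix)) = (q - 1)\<^sup>2"
proof -
  interpret half_quadric ty n q "rep ` internal_points" by (rule half_quadric_rep)
  have "inj_on rep internal_points" by (rule inj_on_inverseI[where g = proj_class]) (use rep in auto)
  then have "bij_betw rep internal_points (rep ` internal_points)" by (simp add: inj_on_imp_bij_betw)
  then show ?thesis unfolding null_space_incidence_eq by (rule dim_null_space_perp)
qed

end

theorem corollary6p3:
  fixes q :: nat
  assumes "primepow q" and "odd q" and "CARD('a::{field, finite}) = q"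
  shows "real (fun_space.dim (null_space passant_lines (internal_points :: ('a ^ 3) set set)
           incidence_matrix)) = (real q - 1)\<^sup>2 / 4"
proof -
  interpret odd_finite_field "TYPE('a)" using assms by unfold_locales simp
  have "\<exists>n :: 'a. quad_char n = - 1"
  proof (rule ccontr)
    assume "\<nexists>n :: 'a. quad_char n = - 1"
    then have "quad_char x \<ge> 0" for x :: 'a by (cases x rule: quad_char_cases) auto
    then have "\<forall>x\<in>UNIV. quad_char (x :: 'a) = 0"
      using sum_quad_char sum_nonneg_eq_0_iff[of UNIV "quad_char :: 'a \<Rightarrow> int"] by simp
    then show False by (metis UNIV_I quad_char_1 zero_neq_one)
  qed
  then obtain n :: 'a where n: "quad_char n = - 1" by blast
  interpret nonsplit_quadric "TYPE('a)" n "int q"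
    using n assms by unfold_locales simp_all
  let ?d = "fun_space.dim (null_space passant_lines (internal_points :: ('a ^ 3) set set) incidence_matrix)"
  have "real_of_int (4 * int ?d) = real_of_int ((int q - 1)\<^sup>2)"
    using dim_null_space_incidence by simp
  then show ?thesis by simp
qed

end
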